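(* Let $p>2$. There is no positive number $M$ such that $$\|f(A_1,B_1)-f(A_2,B_2)\|_{\boldsymbol S_p}\le M\,\|f\|_{L^\infty(\mathbb R^2)}\big(\|A_1-A_2\|_{\boldsymbol S_p}+\|B_1-B_2\|_{\boldsymbol S_p}\big)$$ for all bounded functions $f$ on $\mathbb R^2$ with Fourier transform supported in $[-1,1]^2$ and for all finite rank self-adjoint operators $A_1,A_2,B_1,B_2$.
   Context: Here $2<p<\infty$, $\boldsymbol S_p$ is the Schatten--von Neumann class, and operators act on Hilbert space (infinite-dimensional); the operators $A_j$, $B_j$ are not assumed to commute. A bounded function with compactly supported Fourier transform (in the sense of tempered distributions) is identified with its smooth representative. For self-adjoint operators $A,B$ with spectral measures $E_A,E_B$, $f(A,B)$ is defined as the double operator integral $f(A,B)=\iint f(x,y)\,dE_A(x)\,dE_B(y)$; for finite rank self-adjoint $A,B$ this is the finite sum $$f(A,B)=\sum_{\lambda\in\sigma(A)}\sum_{\mu\in\sigma(B)}f(\lambda,\mu)\,E_A(\{\lambda\})\,E_B(\{\mu\}).$$ *)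

theory Defs
  imports "HOL-Analysis.Analysis" "HOL-Probability.Essential_Supremum"
begin

section \<open>Complex Hilbert spaces and their operators\<close>

text \<open>The inner product is linear in the first argument. Completeness, as well as the real vector
space structure and the metric, comes from the class \<^class>\<open>banach\<close>.\<close>

class complex_hilbert = banach +
  fixes scaleC :: "complex \<Rightarrow> 'a \<Rightarrow> 'a" (infixr \<open>*\<^sub>C\<close> 75)
    and cinner :: "'a \<Rightarrow> 'a \<Rightarrow> complex"
  assumes scaleC_add_right: "c *\<^sub>C (x + y) = c *\<^sub>C x + c *\<^sub>C y"
    and scaleC_add_left: "(c + d) *\<^sub>C x = c *\<^sub>C x + d *\<^sub>C x"
    and scaleC_scaleC: "c *\<^sub>C d *\<^sub>C x = (c * d) *\<^sub>C x"
    and scaleR_scaleC: "r *\<^sub>R x = complex_of_real r *\<^sub>C x"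
    and cinner_add_left: "cinner (x + y) z = cinner x z + cinner y z"
    and cinner_scaleC_left: "cinner (c *\<^sub>C x) y = c * cinner x y"
    and cinner_commute: "cinner x y = cnj (cinner y x)"
    and cinner_self: "cinner x x = complex_of_real ((norm x)\<^sup>2)"

lemma scaleC_one: "1 *\<^sub>C x = (x :: 'a :: complex_hilbert)"
  using scaleR_scaleC[of 1 x] by simp

global_interpretation complex_vector: vector_space
  "scaleC :: complex \<Rightarrow> 'a \<Rightarrow> 'a :: complex_hilbert"
  defines cspan = complex_vector.span
    and cdim = complex_vector.dim
  by unfold_locales (simp_all add: scaleC_add_right scaleC_add_left scaleC_scaleC scaleC_one)

definition cfinite_dim :: "'a :: complex_hilbert set \<Rightarrow> bool" where
  "cfinite_dim V \<longleftrightarrow> (\<exists>S. finite S \<and> V \<subseteq> cspan S)"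

definition bounded_clinear :: "('a :: complex_hilbert \<Rightarrow> 'a) \<Rightarrow> bool" where
  "bounded_clinear T \<longleftrightarrow> bounded_linear T \<and> (\<forall>c x. T (c *\<^sub>C x) = c *\<^sub>C T x)"

definition finite_rank :: "('a :: complex_hilbert \<Rightarrow> 'a) \<Rightarrow> bool" where
  "finite_rank T \<longleftrightarrow> bounded_clinear T \<and> cfinite_dim (range T)"

definition selfadjoint :: "('a :: complex_hilbert \<Rightarrow> 'a) \<Rightarrow> bool" where
  "selfadjoint T \<longleftrightarrow> bounded_clinear T \<and> (\<forall>x y. cinner (T x) y = cinner x (T y))"

section \<open>Schatten--von Neumann norms\<close>

text \<open>The singular values \<open>s\<^sub>0(T) \<ge> s\<^sub>1(T) \<ge> \<dots>\<close> are the distances, in operator norm, to the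
operators of rank at most \<open>j\<close>. The condition \<^term>\<open>finite_rank R\<close> is needed because
\<^const>\<open>cdim\<close> is \<open>0\<close> on infinite-dimensional spaces.\<close>

definition singular_value :: "('a :: complex_hilbert \<Rightarrow> 'a) \<Rightarrow> nat \<Rightarrow> real" where
  "singular_value T j =
     Inf {onorm (\<lambda>x. T x - R x) | R. finite_rank R \<and> cdim (range R) \<le> j}"

text \<open>Meaningful for \<open>T\<close> of class \<open>S\<^sub>p\<close>; for \<open>T\<close> of finite rank the series has only finitely many
nonzero terms.\<close>

definition schatten_norm :: "real \<Rightarrow> ('a :: complex_hilbert \<Rightarrow> 'a) \<Rightarrow> real" where
  "schatten_norm p T = (\<Sum>j. singular_value T j powr p) powr (1 / p)"

section \<open>Functions of two finite rank self-adjoint operators\<close>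

definition spectrum :: "('a :: complex_hilbert \<Rightarrow> 'a) \<Rightarrow> complex set" where
  "spectrum A = {z. \<not> (\<exists>R. bounded_clinear R \<and>
     (\<forall>x. R (A x - z *\<^sub>C x) = x) \<and> (\<forall>x. A (R x) - z *\<^sub>C R x = x))}"

definition real_spectrum :: "('a :: complex_hilbert \<Rightarrow> 'a) \<Rightarrow> real set" where
  "real_spectrum A = {t. complex_of_real t \<in> spectrum A}"

definition orth_proj :: "'a :: complex_hilbert set \<Rightarrow> 'a \<Rightarrow> 'a" where
  "orth_proj V x = (THE y. y \<in> V \<and> (\<forall>v\<in>V. cinner (x - y) v = 0))"

text \<open>A self-adjoint operator of finite rank is diagonalizable, and its spectral measure assigns
to a set \<open>D\<close> the orthogonal projection onto the closed linear span of the eigenvectors with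
eigenvalue in \<open>D\<close>; in particular \<open>{t}\<close> is sent to the projection onto the kernel of \<open>A - t\<close>.\<close>

definition spectral_measure :: "('a :: complex_hilbert \<Rightarrow> 'a) \<Rightarrow> real set \<Rightarrow> 'a \<Rightarrow> 'a" where
  "spectral_measure A D =
     orth_proj (closure (cspan {x. \<exists>t\<in>D. A x = complex_of_real t *\<^sub>C x}))"

text \<open>The double operator integral \<open>\<integral>\<integral> f(x, y) dE\<^sub>A(x) dE\<^sub>B(y)\<close> for finite rank self-adjoint
\<open>A\<close> and \<open>B\<close>, whose spectra are finite subsets of the real line.\<close>

definition fun_op ::
    "(real \<times> real \<Rightarrow> complex) \<Rightarrow> ('a :: complex_hilbert \<Rightarrow> 'a) \<Rightarrow> ('a \<Rightarrow> 'a) \<Rightarrow> 'a \<Rightarrow> 'a" where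
  "fun_op f A B x =
     (\<Sum>s\<in>real_spectrum A. \<Sum>t\<in>real_spectrum B.
        f (s, t) *\<^sub>C spectral_measure A {s} (spectral_measure B {t} x))"

section \<open>Band-limited functions on the plane\<close>

text \<open>\<open>F i j\<close> is the partial derivative of \<open>f\<close> of order \<open>i\<close> in the first and \<open>j\<close> in the second
variable.\<close>

definition smooth :: "(real \<times> real \<Rightarrow> complex) \<Rightarrow> bool" where
  "smooth f \<longleftrightarrow> (\<exists>F :: nat \<Rightarrow> nat \<Rightarrow> real \<times> real \<Rightarrow> complex. F 0 0 = f \<and>
     (\<forall>i j. continuous_on UNIV (F i j) \<and>
       (\<forall>x y. ((\<lambda>s. F i j (s, y)) has_vector_derivative F (Suc i) j (x, y)) (at x) \<and>
              ((\<lambda>t. F i j (x, t)) has_vector_derivative F i (Suc j) (x, y)) (at y))))"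

definition fun_support :: "(real \<times> real \<Rightarrow> complex) \<Rightarrow> (real \<times> real) set" where
  "fun_support g = closure {z. g z \<noteq> 0}"

definition test_function :: "(real \<times> real \<Rightarrow> complex) \<Rightarrow> bool" where
  "test_function g \<longleftrightarrow> smooth g \<and> compact (fun_support g)"

definition fourier :: "(real \<times> real \<Rightarrow> complex) \<Rightarrow> real \<times> real \<Rightarrow> complex" where
  "fourier g w = (\<integral>z. g z * cis (- (z \<bullet> w)) \<partial>lborel)"

text \<open>The Fourier transform of a bounded measurable \<open>f\<close> as a tempered distribution:
\<open>\<langle>f\<^sup>^, g\<rangle> = \<langle>f, g\<^sup>^\<rangle>\<close>. Only its values on test functions matter for the support.\<close>

definition fourier_distr :: "(real \<times> real \<Rightarrow> complex) \<Rightarrow> (real \<times> real \<Rightarrow> complex) \<Rightarrow> complex" where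
  "fourier_distr f g = (\<integral>w. f w * fourier g w \<partial>lborel)"

text \<open>The support of a distribution is the complement of the union of all open sets on which it
vanishes.\<close>

definition distr_support :: "((real \<times> real \<Rightarrow> complex) \<Rightarrow> complex) \<Rightarrow> (real \<times> real) set" where
  "distr_support u =
     - \<Union>{U. open U \<and> (\<forall>g. test_function g \<and> fun_support g \<subseteq> U \<longrightarrow> u g = 0)}"

definition Linf_norm :: "(real \<times> real \<Rightarrow> complex) \<Rightarrow> real" where
  "Linf_norm f = real_of_ereal (esssup lborel (\<lambda>z. ereal (norm (f z))))"

end

theory Submission
  imports Defs "HOL-Probability.Sinc_Integral" "HOL-Complex_Analysis.Cauchy_Integral_Formula"
begin

text \<open>Let \<open>u\<close> be an orthonormal system of \<open>n\<close> vectors and \<open>v\<close> its discrete Fourier transform. The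
operators \<open>A\<^sub>1\<close> and \<open>A\<^sub>2\<close> are diagonal in \<open>u\<close>, with eigenvalues \<open>l j\<close> and \<open>l j + 2\<pi>\<close>, and \<open>B\<close> is
diagonal in \<open>v\<close> with eigenvalues \<open>l k\<close>. Since \<open>A\<^sub>1 - A\<^sub>2\<close> is \<open>-2\<pi>\<close> times a projection of rank \<open>n\<close>,
its norm is at most \<open>2\<pi> n\<^bsup>1/p\<^esup>\<close>. The Fejer kernel \<open>(sin(x/2) / (x/2))\<^sup>2\<close> has spectrum in
\<open>[-1, 1]\<close> and vanishes on \<open>2\<pi>\<int> - {0}\<close>, so it interpolates arbitrary unimodular values at the points
\<open>(l j, l k)\<close> by a function \<open>f\<close> which vanishes at \<open>(l j + 2\<pi>, l k)\<close>; if the \<open>l j\<close> are far apart,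
then \<open>|f| \<le> 4\<close>. Choosing the values to be the conjugate phases of \<open>\<langle>v k, u j\<rangle>\<close> makes \<open>f(A\<^sub>2, B) = 0\<close>
and \<open>f(A\<^sub>1, B)\<close> an operator of rank one and norm \<open>\<surd>n\<close>, which outgrows \<open>n\<^bsup>1/p\<^esup>\<close> for \<open>p > 2\<close>.\<close>

section \<open>Inner products and bounded operators\<close>

lemma cinner_add_right: "cinner x (y + z) = cinner x y + cinner x z"
  for x y z :: "'a :: complex_hilbert"
  by (metis cinner_add_left cinner_commute complex_cnj_add)

lemma cinner_scaleC_right: "cinner x (c *\<^sub>C y) = cnj c * cinner x y"
  for x y :: "'a :: complex_hilbert"
  by (metis cinner_scaleC_left cinner_commute complex_cnj_mult)

lemma cinner_zero_left [simp]: "cinner 0 y = 0" for y :: "'a :: complex_hilbert"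
  using cinner_add_left[of 0 0 y] by simp

lemma cinner_zero_right [simp]: "cinner y 0 = 0" for y :: "'a :: complex_hilbert"
  using cinner_add_right[of y 0 0] by simp

lemma cinner_diff_left: "cinner (x - y) z = cinner x z - cinner y z"
  for x y z :: "'a :: complex_hilbert"
  using cinner_add_left[of "x - y" y z] by (simp add: algebra_simps)

lemma cinner_diff_right: "cinner z (x - y) = cinner z x - cinner z y"
  for x y z :: "'a :: complex_hilbert"
  using cinner_add_right[of z "x - y" y] by (simp add: algebra_simps)

lemma cinner_sum_left: "cinner (\<Sum>i\<in>I. g i) y = (\<Sum>i\<in>I. cinner (g i) y)"
  for y :: "'a :: complex_hilbert"
  by (induction I rule: infinite_finite_induct) (simp_all add: cinner_add_left)

lemma cinner_sum_right: "cinner y (\<Sum>i\<in>I. g i) = (\<Sum>i\<in>I. cinner y (g i))"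
  for y :: "'a :: complex_hilbert"
  by (induction I rule: infinite_finite_induct) (simp_all add: cinner_add_right)

text \<open>The norm meets non-real scalars through \<open>cinner_self\<close>, so homogeneity is
  read off from the inner product of the scaled vector with itself.\<close>

lemma norm_scaleC: "norm (c *\<^sub>C x) = cmod c * norm x" for x :: "'a :: complex_hilbert"
proof -
  have "complex_of_real ((norm (c *\<^sub>C x))\<^sup>2) = complex_of_real ((cmod c * norm x)\<^sup>2)"
  proof -
    have "complex_of_real ((norm (c *\<^sub>C x))\<^sup>2) = (c * cnj c) * cinner x x"
      unfolding cinner_self[symmetric] by (simp add: cinner_scaleC_left cinner_scaleC_right)
    also have "\<dots> = complex_of_real ((cmod c)\<^sup>2 * (norm x)\<^sup>2)"
      by (simp only: of_real_mult complex_norm_square cinner_self)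
    finally show ?thesis by (simp only: power_mult_distrib)
  qed
  then have "(norm (c *\<^sub>C x))\<^sup>2 = (cmod c * norm x)\<^sup>2"
    using of_real_eq_iff by blast
  then show ?thesis by simp
qed

lemma norm_eq_sqrt_cinner: "cinner x x = complex_of_real r \<Longrightarrow> norm x = sqrt r"
  for x :: "'a :: complex_hilbert"
  by (metis abs_norm_cancel cinner_self of_real_eq_iff real_sqrt_abs)

lemma complex_cauchy_schwarz: "cmod (cinner x y) \<le> norm x * norm y"
  for x y :: "'a :: complex_hilbert"
proof (cases "y = 0")
  case False
  \<comment> \<open>\<open>c *\<^sub>C y\<close> is the orthogonal projection of \<open>x\<close>
    onto the line of \<open>y\<close>; the inequality says that the residual has nonnegative squared
    norm.\<close>
  define c where "c = cinner x y / complex_of_real ((norm y)\<^sup>2)"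
  have "complex_of_real ((norm (x - c *\<^sub>C y))\<^sup>2) = cinner x x - cnj c * cinner x y
      - c * cinner y x + c * cnj c * cinner y y"
    unfolding cinner_self[symmetric]
    by (simp add: cinner_diff_left cinner_diff_right cinner_scaleC_left cinner_scaleC_right
        algebra_simps)
  also have "\<dots> = complex_of_real ((norm x)\<^sup>2 - (cmod (cinner x y))\<^sup>2 / (norm y)\<^sup>2)"
    using False unfolding c_def cinner_commute[of y x] cinner_self of_real_diff of_real_divide
      complex_norm_square by (simp add: field_simps power2_eq_square)
  finally have "(norm x)\<^sup>2 - (cmod (cinner x y))\<^sup>2 / (norm y)\<^sup>2 = (norm (x - c *\<^sub>C y))\<^sup>2"
    using of_real_eq_iff by metis
  then have "(norm x)\<^sup>2 - (cmod (cinner x y))\<^sup>2 / (norm y)\<^sup>2 \<ge> 0" by simp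
  then have "(cmod (cinner x y))\<^sup>2 \<le> (norm x * norm y)\<^sup>2"
    using False by (simp add: field_simps power_mult_distrib)
  then show ?thesis by (rule power2_le_imp_le) simp
qed simp

lemma bounded_linear_cinner_left: "bounded_linear (\<lambda>x. cinner x y)"
  for y :: "'a :: complex_hilbert"
proof (rule bounded_linear_intro[where K = "norm y"])
  show "cinner (r *\<^sub>R x) y = r *\<^sub>R cinner x y" for r x
    by (simp add: scaleR_scaleC cinner_scaleC_left scaleR_conv_of_real)
qed (simp_all add: cinner_add_left complex_cauchy_schwarz)

lemma bounded_linear_scaleC_left: "bounded_linear (\<lambda>c. c *\<^sub>C x)"
  for x :: "'a :: complex_hilbert"
  by (rule bounded_linear_intro[where K = "norm x"])
    (simp_all add: scaleC_add_left scaleR_scaleC scaleC_scaleC scaleR_conv_of_real norm_scaleC)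

lemma bounded_linear_scaleC_right: "bounded_linear (\<lambda>x. c *\<^sub>C x)"
  for x :: "'a :: complex_hilbert"
  by (rule bounded_linear_intro[where K = "cmod c"])
    (simp_all add: scaleC_add_right scaleR_scaleC scaleC_scaleC norm_scaleC mult.commute)

lemma bounded_clinear_0: "bounded_clinear (\<lambda>x. 0)"
  by (simp add: bounded_clinear_def)

lemma bounded_clinear_scaleC: "bounded_clinear (\<lambda>x. c *\<^sub>C x)"
  by (simp add: bounded_clinear_def bounded_linear_scaleC_right scaleC_scaleC mult.commute)

lemma bounded_clinear_add:
  "bounded_clinear S \<Longrightarrow> bounded_clinear T \<Longrightarrow> bounded_clinear (\<lambda>x. S x + T x)"
  by (simp add: bounded_clinear_def bounded_linear_add scaleC_add_right)

lemma bounded_clinear_sum: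
  "(\<And>i. i \<in> I \<Longrightarrow> bounded_clinear (T i)) \<Longrightarrow> bounded_clinear (\<lambda>x. \<Sum>i\<in>I. T i x)"
  by (induction I rule: infinite_finite_induct)
    (simp_all add: bounded_clinear_0 bounded_clinear_add)

lemma bounded_clinear_rank_one: "bounded_clinear (\<lambda>x. (c * cinner x u) *\<^sub>C v)"
proof -
  have "bounded_linear (\<lambda>x. (c * cinner x u) *\<^sub>C v)"
    using bounded_linear_compose[OF bounded_linear_scaleC_left
        bounded_linear_compose[OF bounded_linear_mult_right bounded_linear_cinner_left]] .
  then show ?thesis
    by (simp add: bounded_clinear_def cinner_scaleC_left scaleC_scaleC mult.left_commute)
qed

lemma cdim_le_card:
  fixes V :: "'a :: complex_hilbert set"
  assumes "finite S" "V \<subseteq> cspan S"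
  shows "cdim V \<le> card S"
  using complex_vector.dim_le_card[OF assms(2,1)] .

section \<open>Singular values\<close>

text \<open>Supplies the lower bound 0 that the infimum in \<open>singular_value\<close>
  requires.\<close>

lemma onorm_diff_finite_rank_nonneg:
  fixes T :: "'a :: complex_hilbert \<Rightarrow> 'a"
  assumes "bounded_clinear T"
    and "r \<in> {onorm (\<lambda>x. T x - R x) | R. finite_rank R \<and> cdim (range R) \<le> j}"
  shows "r \<ge> 0"
  using assms
  by (auto simp: finite_rank_def bounded_clinear_def intro!: onorm_pos_le bounded_linear_sub)

lemma finite_rank_0: "finite_rank (\<lambda>x. 0 :: 'a :: complex_hilbert)"
  by (auto simp: finite_rank_def bounded_clinear_0 cfinite_dim_def
      intro!: exI[of _ "{}"] complex_vector.span_zero)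

lemma cdim_range_0: "cdim {0 :: 'a :: complex_hilbert} = 0"
  using cdim_le_card[of "{}" "{0 :: 'a}"] by (simp add: complex_vector.span_zero)

lemma singular_value_le:
  assumes "bounded_clinear T" "finite_rank R" "cdim (range R) \<le> j"
  shows "singular_value T j \<le> onorm (\<lambda>x. T x - R x)"
  unfolding singular_value_def
  using assms onorm_diff_finite_rank_nonneg[OF assms(1)]
  by (intro cInf_lower bdd_belowI[where m = 0]) auto

lemma singular_value_nonneg:
  fixes T :: "'a :: complex_hilbert \<Rightarrow> 'a"
  assumes "bounded_clinear T"
  shows "singular_value T j \<ge> 0"
proof -
  have "{onorm (\<lambda>x. T x - R x) | R. finite_rank R \<and> cdim (range R) \<le> j} \<noteq> {}"
    using finite_rank_0[where 'a = 'a] cdim_range_0[where 'a = 'a]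
    by (auto intro!: exI[of _ "\<lambda>x. 0"])
  then show ?thesis
    unfolding singular_value_def
    using onorm_diff_finite_rank_nonneg[OF assms] by (intro cInf_greatest) blast+
qed

lemma singular_value_le_onorm:
  fixes T :: "'a :: complex_hilbert \<Rightarrow> 'a"
  assumes "bounded_clinear T"
  shows "singular_value T j \<le> onorm T"
  using singular_value_le[OF assms finite_rank_0, of j] cdim_range_0[where 'a = 'a] by simp

text \<open>\<open>T\<close> is itself an admissible approximant, with error 0.\<close>

lemma singular_value_eq_0:
  assumes "finite_rank T" "cdim (range T) \<le> j"
  shows "singular_value T j = 0"
proof (rule antisym)
  show "singular_value T j \<le> 0"
    using singular_value_le[of T, OF _ assms] assms(1) by (simp add: finite_rank_def onorm_zero)
  show "singular_value T j \<ge> 0"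
    using assms(1) by (simp add: finite_rank_def singular_value_nonneg)
qed

text \<open>An approximant of rank 0 is the zero operator, so the infimum runs over the single value
  \<open>onorm T\<close>.\<close>

lemma singular_value_0:
  fixes T :: "'a :: complex_hilbert \<Rightarrow> 'a"
  assumes "bounded_clinear T"
  shows "singular_value T 0 = onorm T"
proof (rule antisym)
  have "R x = 0" if R: "finite_rank R" "cdim (range R) \<le> 0" for R :: "'a \<Rightarrow> 'a" and x
  proof -
    obtain S where S: "finite S" "range R \<subseteq> cspan S"
      using R by (auto simp: finite_rank_def cfinite_dim_def)
    obtain B where B: "B \<subseteq> range R" "complex_vector.independent B" "range R \<subseteq> cspan B"
        "card B = cdim (range R)"
      using complex_vector.basis_exists by blast
    \<comment> \<open>Finiteness has to come from \<open>finite_rank\<close>: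
      \<open>card B = 0\<close> alone would also allow an infinite \<open>B\<close>.\<close>
    have "finite B"
      using complex_vector.independent_span_bound[OF S(1) B(2)] B(1) S(2) by blast
    then have "B = {}" using B(4) R(2) by simp
    then show ?thesis using B(3) by auto
  qed
  then have "R = (\<lambda>x. 0)" if "finite_rank R" "cdim (range R) \<le> 0" for R :: "'a \<Rightarrow> 'a"
    using that by blast
  then have "r = onorm T"
    if "r \<in> {onorm (\<lambda>x. T x - R x) | R. finite_rank R \<and> cdim (range R) \<le> 0}" for r
    using that by force
  moreover have "{onorm (\<lambda>x. T x - R x) | R. finite_rank R \<and> cdim (range R) \<le> 0} \<noteq> {}"
    using finite_rank_0[where 'a = 'a] cdim_range_0[where 'a = 'a]
    by (auto intro!: exI[of _ "\<lambda>x. 0"])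
  ultimately show "onorm T \<le> singular_value T 0"
    unfolding singular_value_def by (intro cInf_greatest) auto
qed (rule singular_value_le_onorm[OF assms])

lemma schatten_norm_eq_finite_sum:
  fixes T :: "'a :: complex_hilbert \<Rightarrow> 'a"
  assumes "finite_rank T" "cdim (range T) \<le> n"
  shows "schatten_norm p T = (\<Sum>j<n. singular_value T j powr p) powr (1 / p)"
  unfolding schatten_norm_def
  using singular_value_eq_0[OF assms(1)] assms(2)
  by (subst suminf_finite[of "{..<n}"]) auto

text \<open>At most \<open>n\<close> singular values are nonzero, and each is bounded by the
  operator norm. Serves for the upper estimate of \<open>A1 - A2\<close>.\<close>

lemma schatten_norm_le:
  assumes "finite_rank T" "cdim (range T) \<le> n" "p > 0" "onorm T \<le> c"
  shows "schatten_norm p T \<le> real n powr (1 / p) * c"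
proof -
  have T: "bounded_clinear T" using assms(1) by (simp add: finite_rank_def)
  have c: "c \<ge> 0"
    using onorm_pos_le[of T] T assms(4) by (simp add: bounded_clinear_def)
  have "singular_value T j \<le> c" for j
    using singular_value_le_onorm[OF T] assms(4) by (rule order_trans)
  then have "(\<Sum>j<n. singular_value T j powr p) \<le> (\<Sum>j<n. c powr p)"
    using singular_value_nonneg[OF T] assms(3) by (intro sum_mono powr_mono2) auto
  then have "schatten_norm p T \<le> (real n * c powr p) powr (1 / p)"
    unfolding schatten_norm_eq_finite_sum[OF assms(1,2)]
    using assms(3) by (intro powr_mono2) (auto intro!: sum_nonneg)
  also have "\<dots> = real n powr (1 / p) * c"
    using c assms(3) by (simp add: powr_mult powr_powr)
  finally show ?thesis .
qed

lemma schatten_norm_0: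
  assumes "p > 0"
  shows "schatten_norm p (\<lambda>x :: 'a :: complex_hilbert. 0) = 0"
  using assms schatten_norm_eq_finite_sum[OF finite_rank_0, of 0] cdim_range_0 by simp

text \<open>The term \<open>j = 0\<close> of the series alone is
  \<open>onorm T powr p\<close>.\<close>

lemma onorm_le_schatten_norm:
  fixes T :: "'a :: complex_hilbert \<Rightarrow> 'a"
  assumes "finite_rank T" "p > 0"
  shows "onorm T \<le> schatten_norm p T"
proof -
  have T: "bounded_clinear T" using assms(1) by (simp add: finite_rank_def)
  \<comment> \<open>\<open>Suc\<close> keeps the index 0 inside the range of summation when
    \<open>T\<close> has rank 0.\<close>
  define n where "n = Suc (cdim (range T))"
  have "onorm T powr p = singular_value T 0 powr p"
    by (simp add: singular_value_0[OF T])
  also have "\<dots> \<le> (\<Sum>j<n. singular_value T j powr p)"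
    by (rule member_le_sum) (auto simp: n_def)
  finally have "(onorm T powr p) powr (1 / p) \<le> schatten_norm p T"
    unfolding schatten_norm_eq_finite_sum[OF assms(1), of n, unfolded n_def, simplified] n_def
    using assms(2) by (intro powr_mono2) (auto intro: onorm_pos_le)
  then show ?thesis
    using onorm_pos_le[of T] T assms(2) by (simp add: bounded_clinear_def powr_powr)
qed

lemma finite_rank_rank_one:
  fixes v :: "'a :: complex_hilbert"
  shows "finite_rank (\<lambda>x. cinner x w *\<^sub>C v)"
proof -
  have "range (\<lambda>x. cinner x w *\<^sub>C v) \<subseteq> cspan {v}"
    using complex_vector.span_scale[OF complex_vector.span_base[of v "{v}"]] by blast
  then show ?thesis
    using bounded_clinear_rank_one[of 1 w v] unfolding finite_rank_def cfinite_dim_def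
    by (auto intro!: exI[of _ "{v}"])
qed

text \<open>Testing the operator on \<open>w\<close> bounds its operator norm from below, and the
  Schatten norm dominates the operator norm.\<close>

lemma schatten_norm_rank_one_ge:
  fixes v w :: "'a :: complex_hilbert"
  assumes "p > 0"
  shows "norm w * norm v \<le> schatten_norm p (\<lambda>x. cinner x w *\<^sub>C v)"
proof -
  have "norm (cinner w w *\<^sub>C v) / norm w \<le> onorm (\<lambda>x. cinner x w *\<^sub>C v)"
    using bounded_clinear_rank_one[of 1 w v] by (intro le_onorm) (simp add: bounded_clinear_def)
  also have "norm (cinner w w *\<^sub>C v) / norm w = norm w * norm v"
    by (simp add: cinner_self norm_scaleC power2_eq_square norm_mult del: of_real_mult)
  finally show ?thesis
    using onorm_le_schatten_norm[OF finite_rank_rank_one assms] by (rule order_trans)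
qed

section \<open>Diagonal operators\<close>

definition orthonormal :: "nat \<Rightarrow> (nat \<Rightarrow> 'a :: complex_hilbert) \<Rightarrow> bool" where
  "orthonormal n u \<longleftrightarrow> (\<forall>i<n. \<forall>j<n. cinner (u i) (u j) = of_bool (i = j))"

text \<open>For orthonormal \<open>u\<close> the eigenvalue on \<open>u i\<close> is
  \<open>a i\<close>, and the operator vanishes on the orthogonal complement of the system, so 0 has
  to be watched in its spectrum.\<close>

definition diag_op :: "nat \<Rightarrow> (nat \<Rightarrow> 'a :: complex_hilbert) \<Rightarrow> (nat \<Rightarrow> complex) \<Rightarrow> 'a \<Rightarrow> 'a" where
  "diag_op n u a x = (\<Sum>i<n. (a i * cinner x (u i)) *\<^sub>C u i)"

lemma bounded_clinear_diag_op: "bounded_clinear (diag_op n u a)"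
  unfolding diag_op_def[abs_def] by (intro bounded_clinear_sum bounded_clinear_rank_one)

lemma range_diag_op: "range (diag_op n u a) \<subseteq> cspan (u ` {..<n})"
proof -
  have "diag_op n u a x \<in> cspan (u ` {..<n})" for x
    unfolding diag_op_def
    by (intro complex_vector.span_sum complex_vector.span_scale complex_vector.span_base imageI)
  then show ?thesis by blast
qed

lemma finite_rank_diag_op: "finite_rank (diag_op n u a)"
  unfolding finite_rank_def cfinite_dim_def
  by (intro conjI exI[of _ "u ` {..<n}"] bounded_clinear_diag_op range_diag_op) simp

lemma cdim_range_diag_op: "cdim (range (diag_op n u a)) \<le> n"
proof -
  have "cdim (range (diag_op n u a)) \<le> card (u ` {..<n})"
    by (rule cdim_le_card[OF _ range_diag_op]) simp
  also have "\<dots> \<le> n" using card_image_le[of "{..<n}" u] by simp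
  finally show ?thesis .
qed

lemma selfadjoint_diag_op: "selfadjoint (diag_op n u (\<lambda>i. complex_of_real (a i)))"
proof -
  have "cinner (diag_op n u (\<lambda>i. complex_of_real (a i)) x) y
      = cinner x (diag_op n u (\<lambda>i. complex_of_real (a i)) y)" for x y
    unfolding diag_op_def cinner_sum_left cinner_sum_right cinner_scaleC_left cinner_scaleC_right
  proof (intro sum.cong refl)
    fix i
    have "cnj (complex_of_real (a i) * cinner y (u i)) = complex_of_real (a i) * cinner (u i) y"
      using cinner_commute[of "u i" y] by (simp only: complex_cnj_mult complex_cnj_complex_of_real)
    then show "complex_of_real (a i) * cinner x (u i) * cinner (u i) y
        = cnj (complex_of_real (a i) * cinner y (u i)) * cinner x (u i)"
      by (simp only: mult.assoc mult.commute mult.left_commute)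
  qed
  then show ?thesis by (simp add: selfadjoint_def bounded_clinear_diag_op)
qed

lemma cinner_orthonormal_sum:
  assumes "orthonormal n u" "j < n"
  shows "cinner (\<Sum>i<n. c i *\<^sub>C u i) (u j) = c j"
proof -
  have "cinner (\<Sum>i<n. c i *\<^sub>C u i) (u j) = (\<Sum>i<n. if i = j then c i else 0)"
    unfolding cinner_sum_left cinner_scaleC_left
    using assms by (intro sum.cong) (auto simp: orthonormal_def)
  then show ?thesis using assms(2) by simp
qed

lemma cinner_orthonormal_sums:
  assumes "orthonormal n u"
  shows "cinner (\<Sum>i<n. c i *\<^sub>C u i) (\<Sum>i<n. d i *\<^sub>C u i) = (\<Sum>i<n. c i * cnj (d i))"
  unfolding cinner_sum_right cinner_scaleC_right
  using assms by (simp add: cinner_orthonormal_sum mult.commute)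

lemma cinner_diag_op:
  assumes "orthonormal n u" "j < n"
  shows "cinner (diag_op n u a x) (u j) = a j * cinner x (u j)"
  unfolding diag_op_def by (rule cinner_orthonormal_sum[OF assms])

text \<open>Together with the rules below, this turns operator identities, in particular those for
  resolvents, into scalar identities between coefficients.\<close>

lemma diag_op_diag_op:
  assumes "orthonormal n u"
  shows "diag_op n u a (diag_op n u b x) = diag_op n u (\<lambda>i. a i * b i) x"
  by (subst (1 3) diag_op_def) (simp add: cinner_diag_op[OF assms] mult.assoc)

lemma diag_op_scaleC: "diag_op n u a (c *\<^sub>C x) = diag_op n u (\<lambda>i. a i * c) x"
  by (simp add: diag_op_def cinner_scaleC_left mult.assoc)

lemma scaleC_diag_op: "c *\<^sub>C diag_op n u a x = diag_op n u (\<lambda>i. a i * c) x"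
  by (simp add: diag_op_def complex_vector.scale_sum_right scaleC_scaleC mult_ac)

lemma diag_op_add_right: "diag_op n u a (x + y) = diag_op n u a x + diag_op n u a y"
  by (simp add: diag_op_def cinner_add_left sum.distrib scaleC_add_left distrib_left)

lemma diag_op_add: "diag_op n u a x + diag_op n u b x = diag_op n u (\<lambda>i. a i + b i) x"
  by (simp add: diag_op_def sum.distrib[symmetric] scaleC_add_left[symmetric] distrib_right)

lemma diag_op_diff: "diag_op n u a x - diag_op n u b x = diag_op n u (\<lambda>i. a i - b i) x"
  by (simp add: diag_op_def sum_subtractf[symmetric] left_diff_distrib
      complex_vector.scale_left_diff_distrib)

text \<open>A constant coefficient gives \<open>c\<close> times the orthogonal projection onto the
  span of the system, and projections are contractions.\<close>

lemma norm_diag_op_const_le: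
  assumes "orthonormal n u"
  shows "norm (diag_op n u (\<lambda>i. c) x) \<le> cmod c * norm x"
proof -
  define P where "P = diag_op n u (\<lambda>i. complex_of_real 1)"
  \<comment> \<open>\<open>P\<close> is self-adjoint and idempotent, so the squared norm of
    \<open>P x\<close> is \<open>cinner (P x) x\<close>; Cauchy-Schwarz then gives the
    contraction.\<close>
  have "complex_of_real ((norm (P x))\<^sup>2) = cinner (P (P x)) x"
    using selfadjoint_diag_op[of n u "\<lambda>_. 1"] unfolding cinner_self[symmetric] P_def selfadjoint_def
    by metis
  also have "P (P x) = P x" by (simp add: P_def diag_op_diag_op[OF assms])
  finally have "(norm (P x))\<^sup>2 = cmod (cinner (P x) x)"
    by (metis abs_of_nonneg norm_of_real zero_le_power2)
  then have "norm (P x) * norm (P x) \<le> norm (P x) * norm x"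
    using complex_cauchy_schwarz[of "P x" x] by (simp add: power2_eq_square)
  then have "norm (P x) \<le> norm x" by (cases "norm (P x) = 0") auto
  moreover have "diag_op n u (\<lambda>i. c) x = c *\<^sub>C P x"
    by (simp add: P_def scaleC_diag_op)
  ultimately show ?thesis by (simp add: norm_scaleC mult_left_mono)
qed

section \<open>Spectra and spectral projections of diagonal operators\<close>

text \<open>Off these values the resolvent can be written down explicitly; 0 accounts for the
  orthogonal complement of the system.\<close>

lemma real_spectrum_diag_op_subset:
  assumes "orthonormal n u"
  shows "real_spectrum (diag_op n u (\<lambda>i. complex_of_real (a i))) \<subseteq> insert 0 (a ` {..<n})"
proof
  fix t assume t: "t \<in> real_spectrum (diag_op n u (\<lambda>i. complex_of_real (a i)))"
  let ?D = "diag_op n u" and ?a = "\<lambda>i. complex_of_real (a i)" and ?t = "complex_of_real t"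
  show "t \<in> insert 0 (a ` {..<n})"
  proof (rule ccontr)
    assume nt: "t \<notin> insert 0 (a ` {..<n})"
    \<comment> \<open>The resolvent must be \<open>- 1 / t\<close> on the complement and
      \<open>1 / (a i - t)\<close> on \<open>u i\<close>; \<open>b i\<close> is the difference of
      the two.\<close>
    define b where "b i = 1 / (?a i - ?t) + 1 / ?t" for i
    define R where "R x = (- 1 / ?t) *\<^sub>C x + ?D b x" for x
    have ab: "?a i * (- 1 / ?t) + ?a i * b i - b i * ?t = 0" if "i < n" for i
    proof -
      have "?a i - ?t \<noteq> 0" "?t \<noteq> 0" using nt that by auto
      then show ?thesis unfolding b_def by (simp add: field_simps)
    qed
    have D0: "?D c x = 0" if "\<And>i. i < n \<Longrightarrow> c i = 0" for c x
      using that by (simp add: diag_op_def)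
    have t0: "?t * (- 1 / ?t) = - 1" "(- 1 / ?t) * ?t = - 1" using nt by auto
    have "bounded_clinear R"
      unfolding R_def[abs_def]
      by (intro bounded_clinear_add bounded_clinear_scaleC bounded_clinear_diag_op)
    moreover have "?D ?a (R x) - ?t *\<^sub>C R x = x" for x
    proof -
      have "?D ?a (R x) - ?t *\<^sub>C R x
          = ?D (\<lambda>i. ?a i * (- 1 / ?t) + ?a i * b i - b i * ?t) x - (?t * (- 1 / ?t)) *\<^sub>C x"
        unfolding R_def diag_op_add_right diag_op_diag_op[OF assms] diag_op_scaleC
          scaleC_add_right scaleC_scaleC scaleC_diag_op diag_op_add
        by (simp only: diag_op_diff[symmetric]) (simp add: algebra_simps)
      also have "\<dots> = x" using D0[OF ab] unfolding t0 by (simp add: scaleC_one)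
      finally show ?thesis .
    qed
    moreover have "R (?D ?a x - ?t *\<^sub>C x) = x" for x
    proof -
      have "R (?D ?a x - ?t *\<^sub>C x) = R (?D ?a x + (- ?t) *\<^sub>C x)"
        by simp
      also have "\<dots> = ?D (\<lambda>i. ?a i * (- 1 / ?t) + b i * ?a i + b i * (- ?t)) x
          + ((- 1 / ?t) * (- ?t)) *\<^sub>C x"
        unfolding R_def diag_op_add_right diag_op_diag_op[OF assms] diag_op_scaleC
          scaleC_add_right scaleC_scaleC scaleC_diag_op
        by (simp only: diag_op_add[symmetric]) (simp add: algebra_simps)
      also have "?D (\<lambda>i. ?a i * (- 1 / ?t) + b i * ?a i + b i * (- ?t)) x = 0"
        using ab by (intro D0) (simp add: mult.commute)
      finally show ?thesis using t0 by (simp add: scaleC_one)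
    qed
    ultimately have "?t \<notin> spectrum (?D ?a)"
      unfolding spectrum_def by blast
    then show False using t by (simp add: real_spectrum_def)
  qed
qed

text \<open>\<open>A - t\<close> annihilates the eigenvector, so it has no linear left
  inverse.\<close>

lemma real_spectrum_eigenvalue:
  assumes "A x = complex_of_real t *\<^sub>C x" "x \<noteq> 0"
  shows "t \<in> real_spectrum A"
proof -
  have False if "bounded_clinear R" "\<And>x. R (A x - complex_of_real t *\<^sub>C x) = x" for R
  proof -
    have "R 0 = 0" using that(1) by (simp add: bounded_clinear_def linear_simps)
    then show False using that(2)[of x] assms by simp
  qed
  then show ?thesis unfolding real_spectrum_def spectrum_def by blast
qed

lemma diag_op_unit_vector:
  assumes "orthonormal n u" "i < n"
  shows "diag_op n u a (u i) = a i *\<^sub>C u i"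
proof -
  have "diag_op n u a (u i) = (\<Sum>j<n. if j = i then a j *\<^sub>C u j else 0)"
    unfolding diag_op_def using assms
    by (intro sum.cong) (auto simp: orthonormal_def)
  then show ?thesis using assms(2) by simp
qed

lemma orthonormal_nonzero: "orthonormal n u \<Longrightarrow> i < n \<Longrightarrow> u i \<noteq> 0"
  by (force simp: orthonormal_def)

text \<open>A line is already a closed subspace, so \<open>cspan\<close> and \<open>closure\<close>
  do not enlarge it.\<close>

lemma orth_proj_line:
  fixes u :: "'a :: complex_hilbert"
  assumes "cinner u u = 1" "V = range (\<lambda>c. c *\<^sub>C u)"
  shows "orth_proj (closure (cspan V)) x = cinner x u *\<^sub>C u"
proof -
  \<comment> \<open>Written as the set where two continuous maps agree, \<open>V\<close> is visibly
    closed.\<close>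
  have V: "V = {y. cinner y u *\<^sub>C u = y}"
  proof (intro set_eqI iffI)
    fix y assume "y \<in> V"
    then obtain c where "y = c *\<^sub>C u" using assms(2) by blast
    then show "y \<in> {y. cinner y u *\<^sub>C u = y}" using assms(1) by (simp add: cinner_scaleC_left)
  next
    fix y assume "y \<in> {y. cinner y u *\<^sub>C u = y}"
    then have "y = cinner y u *\<^sub>C u" by simp
    then show "y \<in> V" unfolding assms(2) by (rule range_eqI)
  qed
  have span: "cspan V = V"
    unfolding assms(2) complex_vector.span_singleton[symmetric] by (rule complex_vector.span_span)
  have "closed V"
    unfolding V
    by (intro closed_Collect_eq continuous_on_id bounded_linear.continuous_on[OF
          bounded_linear_scaleC_left] bounded_linear.continuous_on[OF bounded_linear_cinner_left])
  then have closure: "closure (cspan V) = V" by (simp only: span closure_closed)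
  show ?thesis
    unfolding orth_proj_def closure
  proof (rule the_equality)
    have "cinner (x - cinner x u *\<^sub>C u) v = 0" if v: "v \<in> V" for v
    proof -
      obtain c where "v = c *\<^sub>C u" using v assms(2) by blast
      then show ?thesis
        using assms(1) by (simp add: cinner_diff_left cinner_scaleC_left cinner_scaleC_right)
    qed
    then show "cinner x u *\<^sub>C u \<in> V \<and> (\<forall>v\<in>V. cinner (x - cinner x u *\<^sub>C u) v = 0)"
      using assms(2) by blast
  next
    fix y assume y: "y \<in> V \<and> (\<forall>v\<in>V. cinner (x - y) v = 0)"
    have "u \<in> V" using assms(1) by (simp add: V)
    then have "cinner (x - y) u = 0" using y by blast
    then have "cinner x u = cinner y u" by (simp add: cinner_diff_left)
    then show "y = cinner x u *\<^sub>C u" using y by (simp add: V)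
  qed
qed

text \<open>Injectivity of \<open>a\<close> keeps the other \<open>u j\<close> out of the
  eigenspace, and \<open>a i \<noteq> 0\<close> keeps out the orthogonal complement; the line of
  \<open>u i\<close> remains.\<close>

lemma spectral_measure_diag_op:
  assumes u: "orthonormal n u" and "inj_on a {..<n}" "i < n" "a i \<noteq> 0"
  shows "spectral_measure (diag_op n u (\<lambda>i. complex_of_real (a i))) {a i} x
    = cinner x (u i) *\<^sub>C u i"
proof -
  let ?D = "diag_op n u (\<lambda>i. complex_of_real (a i))"
  have "y \<in> range (\<lambda>c. c *\<^sub>C u i)" if y: "?D y = complex_of_real (a i) *\<^sub>C y" for y
  proof -
    have 0: "cinner y (u j) = 0" if "j < n" "j \<noteq> i" for j
    proof -
      have "complex_of_real (a j) * cinner y (u j) = complex_of_real (a i) * cinner y (u j)"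
        using cinner_diag_op[OF u that(1), of "\<lambda>i. complex_of_real (a i)" y] y
        by (auto simp: cinner_scaleC_left)
      moreover have "a j \<noteq> a i" using assms(2,3) that by (auto dest: inj_onD)
      ultimately show ?thesis by auto
    qed
    have "?D y = (\<Sum>j<n. if j = i then (a j * cinner y (u j)) *\<^sub>C u j else 0)"
      unfolding diag_op_def using 0 by (intro sum.cong) auto
    then have "complex_of_real (a i) *\<^sub>C y = complex_of_real (a i) *\<^sub>C (cinner y (u i) *\<^sub>C u i)"
      using y assms(3) by (simp add: scaleC_scaleC)
    then have "y = cinner y (u i) *\<^sub>C u i"
      using assms(4) by (simp only: complex_vector.scale_cancel_left) simp
    then show ?thesis by blast
  qed
  moreover have "?D (c *\<^sub>C u i) = complex_of_real (a i) *\<^sub>C (c *\<^sub>C u i)" for c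
    using diag_op_unit_vector[OF u assms(3), of "\<lambda>i. complex_of_real (a i) * c"]
    by (simp add: diag_op_scaleC scaleC_scaleC)
  ultimately have "{x. \<exists>t\<in>{a i}. ?D x = complex_of_real t *\<^sub>C x} = range (\<lambda>c. c *\<^sub>C u i)"
    by auto
  then show ?thesis
    unfolding spectral_measure_def
    using u assms(3) by (intro orth_proj_line) (auto simp: orthonormal_def)
qed

text \<open>Either spectrum may contain 0 besides the listed eigenvalues. As \<open>f\<close>
  vanishes on the coordinate axes, those terms drop out and only rank one projections
  remain.\<close>

lemma fun_op_diag_op:
  assumes u: "orthonormal n u" and a: "inj_on a {..<n}" "\<And>i. i < n \<Longrightarrow> a i \<noteq> 0"
    and v: "orthonormal m v" and b: "inj_on b {..<m}" "\<And>i. i < m \<Longrightarrow> b i \<noteq> 0"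
    and f: "\<And>t. f (0, t) = 0" "\<And>s. f (s, 0) = 0"
  shows "fun_op f (diag_op n u (\<lambda>i. complex_of_real (a i)))
      (diag_op m v (\<lambda>i. complex_of_real (b i))) x
    = (\<Sum>i<n. \<Sum>j<m. (f (a i, b j) * cinner x (v j) * cinner (v j) (u i)) *\<^sub>C u i)"
proof -
  let ?A = "diag_op n u (\<lambda>i. complex_of_real (a i))"
  let ?B = "diag_op m v (\<lambda>i. complex_of_real (b i))"
  let ?g = "\<lambda>s t. f (s, t) *\<^sub>C spectral_measure ?A {s} (spectral_measure ?B {t} x)"
  have A: "a ` {..<n} \<subseteq> real_spectrum ?A" "b ` {..<m} \<subseteq> real_spectrum ?B"
    using diag_op_unit_vector[OF u] orthonormal_nonzero[OF u]
      diag_op_unit_vector[OF v] orthonormal_nonzero[OF v]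
    by (blast intro: real_spectrum_eigenvalue)+
  have A': "finite (real_spectrum ?A)" "finite (real_spectrum ?B)"
    using real_spectrum_diag_op_subset[OF u, of a] real_spectrum_diag_op_subset[OF v, of b]
    by (auto intro: finite_subset)
  have "fun_op f ?A ?B x = (\<Sum>s\<in>real_spectrum ?A. \<Sum>t\<in>b ` {..<m}. ?g s t)"
    unfolding fun_op_def
    using A A' f real_spectrum_diag_op_subset[OF v, of b]
    by (intro sum.cong sum.mono_neutral_right) auto
  also have "\<dots> = (\<Sum>s\<in>a ` {..<n}. \<Sum>t\<in>b ` {..<m}. ?g s t)"
    using A A' f real_spectrum_diag_op_subset[OF u, of a]
    by (intro sum.mono_neutral_right) auto
  also have "\<dots> = (\<Sum>i<n. \<Sum>j<m. ?g (a i) (b j))"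
    by (simp add: sum.reindex[OF a(1)] sum.reindex[OF b(1)])
  also have "\<dots> = (\<Sum>i<n. \<Sum>j<m. (f (a i, b j) * cinner x (v j) * cinner (v j) (u i)) *\<^sub>C u i)"
    using a b by (intro sum.cong)
      (simp_all add: spectral_measure_diag_op[OF u] spectral_measure_diag_op[OF v]
        cinner_scaleC_left scaleC_scaleC mult.assoc)
  finally show ?thesis .
qed

text \<open>Gram-Schmidt: in infinite dimension some vector lies outside the span reached so far,
  and its component orthogonal to that span is normalised.\<close>

lemma orthonormal_exists:
  assumes "\<not> cfinite_dim (UNIV :: 'a :: complex_hilbert set)"
  shows "\<exists>u :: nat \<Rightarrow> 'a. orthonormal n u"
proof (induction n)
  case (Suc n)
  then obtain u :: "nat \<Rightarrow> 'a" where u: "orthonormal n u" by blast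
  have "finite (u ` {..<n})" by simp
  with assms have "\<not> UNIV \<subseteq> cspan (u ` {..<n})" unfolding cfinite_dim_def by blast
  then obtain x where x: "x \<notin> cspan (u ` {..<n})" by blast
  define y where "y = x - diag_op n u (\<lambda>_. 1) x"
  define z where "z = complex_of_real (1 / norm y) *\<^sub>C y"
  have "y \<noteq> 0" using x range_diag_op[of n u "\<lambda>_. 1"] by (auto simp: y_def)
  then have z: "cinner z z = 1"
    by (simp add: z_def cinner_self norm_scaleC norm_divide)
  have zu: "cinner z (u j) = 0" if "j < n" for j
    using cinner_diag_op[OF u that, of "\<lambda>_. 1" x]
    by (simp add: z_def y_def cinner_scaleC_left cinner_diff_left)
  have uz: "cinner (u j) z = 0" if "j < n" for j
    by (subst cinner_commute) (simp add: zu that)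
  have "orthonormal (Suc n) (u(n := z))"
    using u z zu uz by (auto simp: orthonormal_def less_Suc_eq)
  then show ?case by blast
qed (simp add: orthonormal_def)

section \<open>The Fejer kernel\<close>

text \<open>The squared sinc function of \<open>x / 2\<close> in half-angle form, with its limit at
  the removable singularity. The cosine form suits the computation of the Fourier integral.\<close>

definition fejer :: "real \<Rightarrow> real" where
  "fejer x = (if x = 0 then 1 else 2 * (1 - cos x) / x\<^sup>2)"

lemma one_minus_cos_le: "1 - cos x \<le> x\<^sup>2 / 2" for x :: real
proof -
  have "\<bar>sin (x / 2)\<bar>\<^sup>2 \<le> \<bar>x / 2\<bar>\<^sup>2"
    using abs_sin_x_le_abs_x[of "x / 2"] by (intro power_mono) auto
  then show ?thesis
    using cos_double_sin[of "x / 2"] by (simp add: power_divide)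
qed

lemma fejer_nonneg: "fejer x \<ge> 0"
  by (simp add: fejer_def)

lemma fejer_le_1: "fejer x \<le> 1"
  using one_minus_cos_le[of x] by (simp add: fejer_def field_simps)

lemma fejer_le_inverse_square: "x \<noteq> 0 \<Longrightarrow> fejer x \<le> 4 / x\<^sup>2"
  using divide_right_mono[of "2 * (1 - cos x)" 4 "x\<^sup>2"] cos_ge_minus_one[of x]
  by (simp add: fejer_def)

lemma fejer_0 [simp]: "fejer 0 = 1"
  by (simp add: fejer_def)

lemma fejer_grid: "m \<noteq> 0 \<Longrightarrow> fejer (2 * pi * of_int m) = 0"
  using cos_int_2pin[of m] by (simp add: fejer_def)

section \<open>Entire extension of the Fejer kernel\<close>

text \<open>The sinc function as a difference quotient at 0, kept with \<open>sin 0\<close> and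
  \<open>z - 0\<close> to match \<open>pole_lemma_open\<close> on removable singularities.\<close>

definition csinc :: "complex \<Rightarrow> complex" where
  "csinc z = (if z = 0 then deriv sin 0 else (sin z - sin 0) / (z - 0))"

text \<open>Being entire, this extension yields derivatives of every order, so no formula for the
  derivatives of \<open>fejer\<close> is required.\<close>

definition cfejer :: "complex \<Rightarrow> complex" where
  "cfejer z = (csinc (z / 2))\<^sup>2"

lemma holomorphic_cfejer: "cfejer holomorphic_on UNIV"
proof -
  have "csinc holomorphic_on UNIV"
    unfolding csinc_def[abs_def] by (intro pole_lemma_open holomorphic_intros) auto
  then have "(csinc \<circ> (\<lambda>z. z / 2)) holomorphic_on UNIV"
    by (intro holomorphic_on_compose_gen[of _ _ csinc UNIV] holomorphic_intros) auto
  then show ?thesis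
    unfolding cfejer_def[abs_def] by (auto intro!: holomorphic_intros simp: o_def)
qed

lemma cfejer_of_real: "cfejer (complex_of_real x) = complex_of_real (fejer x)"
proof (cases "x = 0")
  case True
  have "deriv sin (0 :: complex) = 1"
    using DERIV_sin[of "0 :: complex"] by (auto intro: DERIV_imp_deriv)
  then show ?thesis using True by (simp add: cfejer_def csinc_def)
next
  case False
  have "cfejer (complex_of_real x) = complex_of_real ((sin (x / 2) / (x / 2))\<^sup>2)"
    using False sin_of_real[of "x / 2", where 'a = complex] by (simp add: cfejer_def csinc_def)
  also have "(sin (x / 2) / (x / 2))\<^sup>2 = fejer x"
    using False cos_double_sin[of "x / 2"] by (simp add: fejer_def field_simps)
  finally show ?thesis .
qed

lemma has_vector_derivative_cfejer:
  "((\<lambda>s. (deriv ^^ i) cfejer (complex_of_real (s - a))) has_vector_derivative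
    (deriv ^^ Suc i) cfejer (complex_of_real (x - a))) (at x)"
proof -
  have "(deriv ^^ i) cfejer holomorphic_on UNIV"
    by (intro holomorphic_higher_deriv holomorphic_cfejer) auto
  then have "((deriv ^^ i) cfejer has_field_derivative (deriv ^^ Suc i) cfejer z) (at z)" for z
    by (auto intro: holomorphic_derivI)
  then have "((\<lambda>w. (deriv ^^ i) cfejer (w - complex_of_real a)) has_field_derivative
      (deriv ^^ Suc i) cfejer (complex_of_real x - complex_of_real a)) (at (complex_of_real x))"
    using DERIV_shift[of "(deriv ^^ i) cfejer" "(deriv ^^ Suc i) cfejer (complex_of_real (x - a))"
        "complex_of_real x" "- complex_of_real a"] by simp
  then show ?thesis
    using has_vector_derivative_real_field by fastforce
qed

lemma continuous_on_cfejer: "continuous_on UNIV ((deriv ^^ i) cfejer)"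
  by (intro holomorphic_on_imp_continuous_on holomorphic_higher_deriv holomorphic_cfejer) auto

lemma continuous_fejer: "continuous_on UNIV fejer"
proof -
  have "continuous_on UNIV (\<lambda>x. Re (cfejer (complex_of_real x)))"
    using continuous_on_compose2[OF continuous_on_cfejer[of 0], of UNIV complex_of_real]
    by (auto intro!: continuous_intros)
  then show ?thesis by (simp add: cfejer_of_real)
qed

lemma fejer_measurable [measurable]: "fejer \<in> borel_measurable borel"
  by (rule borel_measurable_continuous_onI[OF continuous_fejer])

text \<open>\<open>fejer x * cos (t * x)\<close> is a combination of \<open>(1 - cos (a * x)) / x\<^sup>2\<close> with
\<open>a = t + 1\<close>, \<open>t - 1\<close>, \<open>t\<close>; by scaling, the integral of the latter is proportional to \<open>\<bar>a\<bar>\<close>, so the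
value of the constant is irrelevant for the vanishing of the transform outside \<open>[-1, 1]\<close>.\<close>

lemma integrable_one_minus_cos:
  "integrable lborel (\<lambda>x :: real. (1 - cos (a * x)) / x\<^sup>2)"
proof -
  have "integrable lborel (\<lambda>x :: real. inverse (1 + x\<^sup>2))"
    using integrable_inverse_1_plus_square by (simp add: set_integrable_def)
  \<comment> \<open>In the majorant, \<open>a\<^sup>2 / 2\<close> comes from
    \<open>one_minus_cos_le\<close> and 2 from \<open>1 - cos \<le> 2\<close>: they bound the two
    summands after multiplication by \<open>1 + x\<^sup>2\<close>.\<close>
  then have "integrable lborel (\<lambda>x :: real. (a\<^sup>2 / 2 + 2) * inverse (1 + x\<^sup>2))"
    by (rule integrable_mult_right)
  then show ?thesis
  proof (rule Bochner_Integration.integrable_bound)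
    show "AE x in lborel. norm ((1 - cos (a * x)) / x\<^sup>2)
        \<le> norm ((a\<^sup>2 / 2 + 2) * inverse (1 + x\<^sup>2))"
    proof (rule AE_I2)
      fix x :: real
      have "(1 - cos (a * x)) / x\<^sup>2 * (1 + x\<^sup>2) \<le> a\<^sup>2 / 2 + 2"
      proof (cases "x = 0")
        case False
        have "(1 - cos (a * x)) / x\<^sup>2 * (1 + x\<^sup>2) = (1 - cos (a * x)) / x\<^sup>2 + (1 - cos (a * x))"
          using False by (simp add: field_simps)
        moreover have "(1 - cos (a * x)) / x\<^sup>2 \<le> a\<^sup>2 / 2"
          using False one_minus_cos_le[of "a * x"] by (simp add: field_simps)
        ultimately show ?thesis
          using cos_ge_minus_one[of "a * x"] by linarith
      qed simp
      moreover have "1 + x\<^sup>2 > 0" by (simp add: add_pos_nonneg)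
      ultimately have "(1 - cos (a * x)) / x\<^sup>2 \<le> (a\<^sup>2 / 2 + 2) / (1 + x\<^sup>2)"
        by (simp only: pos_le_divide_eq)
      then have "(1 - cos (a * x)) / x\<^sup>2 \<le> \<bar>(a\<^sup>2 / 2 + 2) * inverse (1 + x\<^sup>2)\<bar>"
        unfolding divide_inverse[of _ "1 + x\<^sup>2"] by linarith
      moreover have "(1 - cos (a * x)) / x\<^sup>2 \<ge> 0" by simp
      ultimately show "norm ((1 - cos (a * x)) / x\<^sup>2) \<le> norm ((a\<^sup>2 / 2 + 2) * inverse (1 + x\<^sup>2))"
        by (simp only: real_norm_def abs_of_nonneg)
    qed
  qed simp
qed

lemma integral_one_minus_cos:
  "(\<integral>x. (1 - cos (a * x)) / x\<^sup>2 \<partial>lborel)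
    = \<bar>a\<bar> * (\<integral>x. (1 - cos (x :: real)) / x\<^sup>2 \<partial>lborel)"
proof (cases "a = 0")
  case False
  have "(\<integral>x. (1 - cos (x :: real)) / x\<^sup>2 \<partial>lborel)
      = \<bar>a\<bar> * (\<integral>x. (1 - cos (a * x)) / (a * x)\<^sup>2 \<partial>lborel)"
    using lborel_integral_real_affine[OF False, of "\<lambda>x. (1 - cos x) / x\<^sup>2" 0] by simp
  also have "(\<lambda>x. (1 - cos (a * x)) / (a * x)\<^sup>2) = (\<lambda>x. inverse (a\<^sup>2) * ((1 - cos (a * x)) / x\<^sup>2))"
    by (auto simp: field_simps)
  finally have "(\<integral>x. (1 - cos (x :: real)) / x\<^sup>2 \<partial>lborel)
      = \<bar>a\<bar> * (inverse (a\<^sup>2) * (\<integral>x. (1 - cos (a * x)) / x\<^sup>2 \<partial>lborel))"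
    by (simp only: integral_mult_right_zero)
  then have "\<bar>a\<bar> * (\<integral>x. (1 - cos (x :: real)) / x\<^sup>2 \<partial>lborel)
      = (\<bar>a\<bar> * \<bar>a\<bar> * inverse (a\<^sup>2)) * (\<integral>x. (1 - cos (a * x)) / x\<^sup>2 \<partial>lborel)"
    by simp
  also have "\<bar>a\<bar> * \<bar>a\<bar> * inverse (a\<^sup>2) = 1"
    using False by (simp add: power2_eq_square[symmetric])
  finally show ?thesis by simp
qed simp

text \<open>The product formula for cosines. At \<open>x = 0\<close> it fails: the left side is 1,
  while division by zero makes the right side 0.\<close>

lemma AE_fejer_cos:
  "AE x in lborel. fejer x * cos (t * x) = (1 - cos ((t + 1) * x)) / x\<^sup>2
    + (1 - cos ((t - 1) * x)) / x\<^sup>2 - 2 * ((1 - cos (t * x)) / x\<^sup>2)"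
  using AE_lborel_singleton[of 0]
proof eventually_elim
  case (elim x)
  have "cos ((t + 1) * x) + cos ((t - 1) * x) = 2 * cos (t * x) * cos x"
    by (simp add: distrib_right left_diff_distrib cos_add cos_diff)
  then show ?case
    using elim by (simp add: fejer_def diff_divide_distrib[symmetric] add_divide_distrib[symmetric])
      (simp add: algebra_simps)
qed

lemma integrable_fejer: "integrable lborel fejer"
proof -
  \<comment> \<open>The case \<open>t = 0\<close> of \<open>AE_fejer_cos\<close>, left unsimplified
    so that it matches.\<close>
  have "integrable lborel (\<lambda>x :: real. (1 - cos ((0 + 1) * x)) / x\<^sup>2
      + (1 - cos ((0 - 1) * x)) / x\<^sup>2 - 2 * ((1 - cos (0 * x)) / x\<^sup>2))"
    by (intro Bochner_Integration.integrable_diff Bochner_Integration.integrable_add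
        integrable_mult_right integrable_one_minus_cos)
  then have "integrable lborel (\<lambda>x. fejer x * cos (0 * x))"
    by (rule integrable_cong_AE[THEN iffD2, OF _ _ AE_fejer_cos, rotated -1]) measurable
  then show ?thesis by simp
qed

lemma integral_fejer_cos:
  assumes "\<bar>t\<bar> \<ge> 1"
  shows "(\<integral>x. fejer x * cos (t * x) \<partial>lborel) = 0"
proof -
  let ?k = "\<lambda>a x :: real. (1 - cos (a * x)) / x\<^sup>2"
  have lin: "(\<integral>x. f x + g x - 2 * h x \<partial>lborel)
      = (\<integral>x. f x \<partial>lborel) + (\<integral>x. g x \<partial>lborel) - 2 * (\<integral>x. h x \<partial>lborel)"
    if "integrable lborel f" "integrable lborel g" "integrable lborel h"
    for f g h :: "real \<Rightarrow> real"
    using that by simp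
  have "(\<integral>x. fejer x * cos (t * x) \<partial>lborel)
      = (\<integral>x. ?k (t + 1) x + ?k (t - 1) x - 2 * ?k t x \<partial>lborel)"
    by (intro integral_cong_AE AE_fejer_cos) measurable
  also have "\<dots> = (\<integral>x. ?k (t + 1) x \<partial>lborel) + (\<integral>x. ?k (t - 1) x \<partial>lborel)
      - 2 * (\<integral>x. ?k t x \<partial>lborel)"
    by (intro lin integrable_one_minus_cos)
  also have "\<dots> = (\<bar>t + 1\<bar> + \<bar>t - 1\<bar> - 2 * \<bar>t\<bar>) * (\<integral>x. (1 - cos (x :: real)) / x\<^sup>2 \<partial>lborel)"
    unfolding integral_one_minus_cos by (simp add: algebra_simps)
  \<comment> \<open>The second difference of the absolute value is supported in
    \<open>[-1, 1]\<close>; this is the triangle shape of the Fejer spectrum.\<close>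
  also have "\<bar>t + 1\<bar> + \<bar>t - 1\<bar> - 2 * \<bar>t\<bar> = 0" using assms by auto
  finally show ?thesis by simp
qed

lemma integrable_mult_cis:
  fixes f :: "'a :: euclidean_space \<Rightarrow> complex"
  assumes "integrable lborel f" "h \<in> borel_measurable lborel"
  shows "integrable lborel (\<lambda>x. f x * cis (h x))"
  using assms(1)
proof (rule Bochner_Integration.integrable_bound)
  have [measurable]: "f \<in> borel_measurable lborel" "h \<in> borel_measurable lborel"
    using assms by auto
  have "(\<lambda>x. f x * (complex_of_real (cos (h x)) + \<i> * complex_of_real (sin (h x))))
      \<in> borel_measurable lborel" by measurable
  then show "(\<lambda>x. f x * cis (h x)) \<in> borel_measurable lborel"
    by (simp add: cis_conv_exp exp_Euler cos_of_real sin_of_real)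
qed (simp add: norm_mult)

text \<open>Evenness cancels the sine part and leaves the cosine integral; translation by
  \<open>l\<close> only contributes a unimodular factor.\<close>

lemma fourier_fejer:
  assumes "\<bar>t\<bar> \<ge> 1"
  shows "(\<integral>x. complex_of_real (fejer (x - l)) * cis (- (x * t)) \<partial>lborel) = 0"
proof -
  let ?F = "\<lambda>t x. complex_of_real (fejer x) * cis (t * x)"
  have int: "integrable lborel (?F t)" for t
    using integrable_fejer by (intro integrable_mult_cis) auto
  have even: "fejer (- x) = fejer x" for x by (simp add: fejer_def)
  have "(\<integral>x. ?F (- t) x \<partial>lborel) = (\<integral>x. ?F t x \<partial>lborel)"
    using lborel_integral_real_affine[of "- 1" "?F (- t)" 0] by (simp add: even)
  then have "2 * (\<integral>x. ?F (- t) x \<partial>lborel) = (\<integral>x. ?F (- t) x + ?F t x \<partial>lborel)"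
    by (simp only: Bochner_Integration.integral_add[OF int int] mult_2)
  also have "(\<lambda>x. ?F (- t) x + ?F t x) = (\<lambda>x. complex_of_real (2 * (fejer x * cos (t * x))))"
    by (auto simp: complex_eq_iff)
  also have "(\<integral>x. complex_of_real (2 * (fejer x * cos (t * x))) \<partial>lborel) = 0"
    by (simp only: integral_complex_of_real) (simp add: integral_fejer_cos[OF assms])
  finally have 0: "(\<integral>x. ?F (- t) x \<partial>lborel) = 0" by simp
  have "(\<integral>x. complex_of_real (fejer (x - l)) * cis (- (x * t)) \<partial>lborel)
      = (\<integral>x. complex_of_real (fejer x) * cis (- ((l + x) * t)) \<partial>lborel)"
    using lborel_integral_real_affine[of 1
        "\<lambda>x. complex_of_real (fejer (x - l)) * cis (- (x * t))" l] by simp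
  also have "\<dots> = (\<integral>x. cis (- (l * t)) * ?F (- t) x \<partial>lborel)"
    by (intro Bochner_Integration.integral_cong)
      (auto simp: cis_mult algebra_simps)
  also have "\<dots> = 0" using 0 by simp
  finally show ?thesis .
qed

section \<open>Fourier transforms on the plane\<close>

lemma integrable_lborel_pair_mult:
  fixes f :: "'a :: euclidean_space \<Rightarrow> complex" and g :: "'b :: euclidean_space \<Rightarrow> complex"
  assumes "integrable lborel f" "integrable lborel g"
  shows "integrable (lborel \<Otimes>\<^sub>M lborel) (\<lambda>z. f (fst z) * g (snd z))"
proof (rule lborel_pair.Fubini_integrable)
  have [measurable]: "f \<in> borel_measurable lborel" "g \<in> borel_measurable lborel"
    using assms by auto
  show "(\<lambda>z. f (fst z) * g (snd z)) \<in> borel_measurable (lborel \<Otimes>\<^sub>M lborel)" by measurable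
qed (use assms in \<open>auto simp: norm_mult intro!: integrable_mult_left integrable_norm\<close>)

text \<open>Fubini for a kernel symmetric in the two variables. For integrable \<open>f\<close> the
  distributional transform is thereby the ordinary function \<open>fourier f\<close>.\<close>

lemma fourier_multiplication_formula:
  assumes f: "integrable lborel f" and g: "integrable lborel g"
  shows "fourier_distr f g = (\<integral>z. g z * fourier f z \<partial>lborel)"
proof -
  let ?H = "\<lambda>w z. f w * g z * cis (- (z \<bullet> w))"
  have "(\<lambda>q :: (real \<times> real) \<times> (real \<times> real). - (snd q \<bullet> fst q)) \<in> borel_measurable borel"
    by (intro borel_measurable_continuous_onI continuous_intros)
  then have "integrable (lborel \<Otimes>\<^sub>M lborel) (\<lambda>q. f (fst q) * g (snd q) * cis (- (snd q \<bullet> fst q)))"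
    using integrable_mult_cis[of "\<lambda>q. f (fst q) * g (snd q)" "\<lambda>q. - (snd q \<bullet> fst q)"]
      integrable_lborel_pair_mult[OF f g] by (simp add: lborel_prod)
  then have int: "integrable (lborel \<Otimes>\<^sub>M lborel) (case_prod ?H)"
    by (simp add: case_prod_beta')
  have "fourier_distr f g = (\<integral>w. (\<integral>z. ?H w z \<partial>lborel) \<partial>lborel)"
    by (simp add: fourier_distr_def fourier_def mult.assoc)
  also have "\<dots> = (\<integral>z. (\<integral>w. ?H w z \<partial>lborel) \<partial>lborel)"
    by (rule lborel_pair.Fubini_integral[OF int, symmetric])
  also have "\<dots> = (\<integral>z. g z * fourier f z \<partial>lborel)"
    by (simp add: fourier_def inner_commute mult_ac flip: integral_mult_right_zero)
  finally show ?thesis .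
qed

lemma fourier_tensor:
  assumes "integrable lborel f" "integrable lborel g"
  shows "fourier (\<lambda>z. f (fst z) * g (snd z)) w
    = (\<integral>x. f x * cis (- (x * fst w)) \<partial>lborel) * (\<integral>y. g y * cis (- (y * snd w)) \<partial>lborel)"
proof -
  let ?f = "\<lambda>x. f x * cis (- (x * fst w))" and ?g = "\<lambda>y. g y * cis (- (y * snd w))"
  have "integrable lborel ?f" "integrable lborel ?g"
    using assms by (auto intro!: integrable_mult_cis)
  then have "integrable (lborel \<Otimes>\<^sub>M lborel) (\<lambda>z. ?f (fst z) * ?g (snd z))"
    by (rule integrable_lborel_pair_mult)
  then have "(\<integral>x. (\<integral>y. ?f x * ?g y \<partial>lborel) \<partial>lborel)
      = (\<integral>z. ?f (fst z) * ?g (snd z) \<partial>(lborel \<Otimes>\<^sub>M lborel))"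
    using lborel_pair.integral_fst'[of "\<lambda>z. ?f (fst z) * ?g (snd z)"] by simp
  also have "\<dots> = fourier (\<lambda>z. f (fst z) * g (snd z)) w"
  proof -
    have "cis (- (z \<bullet> w)) = cis (- (fst z * fst w)) * cis (- (snd z * snd w))" for z
      by (simp add: inner_prod_def cis_mult)
    then show ?thesis
      unfolding fourier_def lborel_prod by (simp add: mult_ac)
  qed
  finally show ?thesis by simp
qed

section \<open>Interpolation by translates of the Fejer kernel\<close>

text \<open>When the nodes \<open>l j\<close> are distinct points of \<open>2 * pi\<close> times the
  integers, \<open>c j k\<close> is the value prescribed at \<open>(l j, l k)\<close>.\<close>

definition fejer_interp ::
    "nat \<Rightarrow> (nat \<Rightarrow> real) \<Rightarrow> (nat \<Rightarrow> nat \<Rightarrow> complex) \<Rightarrow> real \<times> real \<Rightarrow> complex" where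
  "fejer_interp n l c z = (\<Sum>j<n. \<Sum>k<n. c j k *
     (complex_of_real (fejer (fst z - l j)) * complex_of_real (fejer (snd z - l k))))"

lemma smooth_fejer_interp: "smooth (fejer_interp n l c)"
proof -
  \<comment> \<open>The partial derivatives are written through derivatives of the entire
    extension.\<close>
  define F where "F i j z = (\<Sum>r<n. \<Sum>s<n. c r s *
     ((deriv ^^ i) cfejer (complex_of_real (fst z - l r)) *
      (deriv ^^ j) cfejer (complex_of_real (snd z - l s))))" for i j :: nat and z
  have "F 0 0 = fejer_interp n l c"
    by (auto simp: F_def fejer_interp_def cfejer_of_real simp flip: of_real_diff)
  moreover have "continuous_on UNIV (F i j)" for i j
  proof -
    have cont: "continuous_on UNIV (\<lambda>z. (deriv ^^ i) cfejer (complex_of_real (h z)))"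
      if "continuous_on UNIV h" for i and h :: "real \<times> real \<Rightarrow> real"
      using that by (intro continuous_on_compose2[OF continuous_on_cfejer[of i]]
          continuous_intros) auto
    show ?thesis
      unfolding F_def[abs_def]
      by (intro cont continuous_on_sum continuous_on_mult continuous_on_const continuous_on_diff
          continuous_on_fst continuous_on_snd continuous_on_id)
  qed
  moreover have "((\<lambda>s. F i j (s, y)) has_vector_derivative F (Suc i) j (x, y)) (at x)" for i j x y
    unfolding F_def fst_conv snd_conv
    by (intro has_vector_derivative_sum bounded_linear.has_vector_derivative[OF
          bounded_linear_mult_right] bounded_linear.has_vector_derivative[OF
          bounded_linear_mult_left] has_vector_derivative_cfejer)
  moreover have "((\<lambda>t. F i j (x, t)) has_vector_derivative F i (Suc j) (x, y)) (at y)" for i j x y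
    unfolding F_def fst_conv snd_conv
    by (intro has_vector_derivative_sum bounded_linear.has_vector_derivative[OF
          bounded_linear_mult_right] has_vector_derivative_cfejer)
  ultimately show ?thesis unfolding smooth_def by blast
qed

lemma fourier_fejer_interp:
  assumes "z \<notin> {-1..1} \<times> {-1..1}"
  shows "integrable lborel (fejer_interp n l c)" "fourier (fejer_interp n l c) z = 0"
proof -
  have i1: "integrable lborel (\<lambda>x. complex_of_real (fejer (x - l j)))" for j
    using lborel_integrable_real_affine[OF integrable_fejer, of 1 "- l j"] by simp
  have int: "integrable lborel (\<lambda>z. c j k * (complex_of_real (fejer (fst z - l j))
      * complex_of_real (fejer (snd z - l k))))" for j k
    using integrable_lborel_pair_mult[OF i1 i1, of j k] by (simp add: lborel_prod)
  show "integrable lborel (fejer_interp n l c)"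
    unfolding fejer_interp_def[abs_def] using int by (intro Bochner_Integration.integrable_sum)
  have "fourier (\<lambda>z. complex_of_real (fejer (fst z - l j))
      * complex_of_real (fejer (snd z - l k))) z = 0" for j k
  proof -
    \<comment> \<open>The transform of each summand factors, and one of the two factors
      vanishes.\<close>
    have "\<bar>fst z\<bar> \<ge> 1 \<or> \<bar>snd z\<bar> \<ge> 1" using assms by (cases z) auto
    then show ?thesis
      unfolding fourier_tensor[OF i1 i1] using fourier_fejer by auto
  qed
  then have "(\<integral>w. c j k * (complex_of_real (fejer (fst w - l j))
      * complex_of_real (fejer (snd w - l k))) * cis (- (w \<bullet> z)) \<partial>lborel) = 0" for j k
    by (simp add: fourier_def mult.assoc)
  then show "fourier (fejer_interp n l c) z = 0"
    unfolding fourier_def fejer_interp_def sum_distrib_right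
    using integrable_mult_cis[OF int]
    by (subst Bochner_Integration.integral_sum | intro Bochner_Integration.integrable_sum | simp)+
qed

lemma integrable_test_function:
  assumes "test_function g"
  shows "integrable lborel g"
proof -
  have "continuous_on UNIV g" "compact (fun_support g)"
    using assms by (auto simp: test_function_def smooth_def)
  then have "set_integrable lborel (fun_support g) g"
    unfolding set_integrable_def
    by (intro borel_integrable_compact) (auto intro: continuous_on_subset)
  moreover have "indicator (fun_support g) x *\<^sub>R g x = g x" for x
    using closure_subset[of "{z. g z \<noteq> 0}"] by (auto simp: fun_support_def indicator_def)
  ultimately show ?thesis by (simp add: set_integrable_def)
qed

text \<open>The complement of the square is an open set on which the distribution vanishes:
  \<open>g\<close> is zero on the square and the transform is zero off it.\<close>

lemma distr_support_fejer_interp: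
  "distr_support (fourier_distr (fejer_interp n l c)) \<subseteq> {-1..1} \<times> {-1..1}"
proof -
  let ?Q = "{-1..1} \<times> {-1..1} :: (real \<times> real) set"
  have "fourier_distr (fejer_interp n l c) g = 0"
    if g: "test_function g" "fun_support g \<subseteq> - ?Q" for g
  proof -
    have "g z * fourier (fejer_interp n l c) z = 0" for z
      using g(2) closure_subset[of "{z. g z \<noteq> 0}"] fourier_fejer_interp(2)[of z n l c]
      by (cases "z \<in> ?Q") (auto simp: fun_support_def)
    then have 0: "(\<lambda>z. g z * fourier (fejer_interp n l c) z) = (\<lambda>z. 0)" by blast
    \<comment> \<open>\<open>(2, 2)\<close> serves as a point outside the square.\<close>
    have "integrable lborel (fejer_interp n l c)"
      using fourier_fejer_interp(1)[of "(2, 2)"] by simp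
    from fourier_multiplication_formula[OF this integrable_test_function[OF g(1)]]
    show ?thesis unfolding 0 by simp
  qed
  moreover have "open (- ?Q)" by (intro open_Compl closed_Times) auto
  ultimately show ?thesis unfolding distr_support_def by blast
qed

section \<open>Uniform bound for the interpolating function\<close>

text \<open>At most one node is near \<open>x\<close> and contributes at most 1; each of the others
  contributes at most \<open>1 / n\<close> by quadratic decay.\<close>

lemma sum_fejer_le_2:
  assumes "\<And>i j. i < n \<Longrightarrow> j < n \<Longrightarrow> i \<noteq> j \<Longrightarrow> \<bar>l i - l j\<bar> \<ge> 2 * pi * real n"
  shows "(\<Sum>j<n. fejer (x - l j)) \<le> 2"
proof (cases "n = 0")
  case False
  \<comment> \<open>The radius is half the separation of the nodes, so two nodes in \<open>J\<close>
    would be too close to each other.\<close>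
  define J where "J = {j \<in> {..<n}. \<bar>x - l j\<bar> < pi * real n}"
  have "i = j" if "i \<in> J" "j \<in> J" for i j
  proof (rule ccontr)
    assume "i \<noteq> j"
    then show False using assms[of i j] that unfolding J_def by auto
  qed
  then have J: "finite J" "card J \<le> 1"
    by (auto simp: J_def card_le_Suc0_iff_eq)
  have le: "fejer (x - l j) \<le> of_bool (j \<in> J) + 1 / real n" if "j < n" for j
  proof (cases "j \<in> J")
    case True
    then show ?thesis using fejer_le_1[of "x - l j"] by (simp add: add_increasing2)
  next
    case j: False
    then have d: "\<bar>x - l j\<bar> \<ge> pi * real n" using that by (auto simp: J_def)
    moreover have pos: "pi * real n > 0" using False by simp
    ultimately have "(x - l j)\<^sup>2 \<ge> (pi * real n)\<^sup>2" "x - l j \<noteq> 0"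
      using power_mono[OF d, of 2] by auto
    then have "4 / (x - l j)\<^sup>2 \<le> 4 / (pi * real n)\<^sup>2"
      using False by (intro divide_left_mono) auto
    then have "fejer (x - l j) \<le> 4 / (pi * real n)\<^sup>2"
      using fejer_le_inverse_square[OF \<open>x - l j \<noteq> 0\<close>] by linarith
    also have "\<dots> \<le> 1 / real n"
    proof -
      have "4 \<le> pi\<^sup>2" using power_mono[OF pi_ge_two, of 2] by simp
      then have "4 * 1 \<le> pi\<^sup>2 * real n" using False by (intro mult_mono) auto
      then show ?thesis using False by (simp add: field_simps power2_eq_square)
    qed
    finally show ?thesis using j by simp
  qed
  have "(\<Sum>j<n. fejer (x - l j)) \<le> (\<Sum>j<n. of_bool (j \<in> J) + 1 / real n)"
    using le by (intro sum_mono) auto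
  also have "\<dots> = real (card J) + 1"
    using False by (simp add: sum.distrib J_def Int_def conj_commute)
  finally show ?thesis using J by simp
qed simp

text \<open>The majorant factors into two one-dimensional sums, each at most 2.\<close>

lemma norm_fejer_interp_le:
  assumes "\<And>i j. i < n \<Longrightarrow> j < n \<Longrightarrow> i \<noteq> j \<Longrightarrow> \<bar>l i - l j\<bar> \<ge> 2 * pi * real n"
    and "\<And>j k. norm (c j k) \<le> 1"
  shows "norm (fejer_interp n l c z) \<le> 4"
proof -
  have "norm (fejer_interp n l c z)
      \<le> (\<Sum>j<n. \<Sum>k<n. fejer (fst z - l j) * fejer (snd z - l k))"
    unfolding fejer_interp_def using assms(2) fejer_nonneg
    by (intro sum_norm_le) (simp add: norm_mult mult_left_le_one_le)
  also have "\<dots> = (\<Sum>j<n. fejer (fst z - l j)) * (\<Sum>k<n. fejer (snd z - l k))"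
    by (simp add: sum_product)
  also have "\<dots> \<le> 2 * 2"
    using fejer_nonneg by (intro mult_mono sum_fejer_le_2[OF assms(1)] sum_nonneg) auto
  finally show ?thesis by simp
qed

lemma Linf_norm_le:
  assumes "continuous_on UNIV f" "\<And>z. norm (f z) \<le> c"
  shows "Linf_norm f \<le> c"
proof -
  have [measurable]: "f \<in> borel_measurable borel"
    using assms(1) by (rule borel_measurable_continuous_onI)
  have "esssup lborel (\<lambda>z. ereal (norm (f z))) \<le> ereal c"
    by (rule esssup_I) (use assms(2) in auto)
  \<comment> \<open>Covers the value minus infinity of \<open>esssup\<close>, which
    \<open>real_of_ereal\<close> sends to 0.\<close>
  moreover have "c \<ge> 0" using assms(2) norm_ge_zero by (rule order_trans[rotated])
  ultimately show ?thesis
    unfolding Linf_norm_def by (cases "esssup lborel (\<lambda>z. ereal (norm (f z)))") auto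
qed

section \<open>The example\<close>

text \<open>For \<open>k \<noteq> m\<close> this is a full geometric sum over powers of an
  \<open>n\<close>-th root of unity other than 1.\<close>

lemma sum_cis_roots:
  assumes "k < n" "m < n"
  shows "(\<Sum>j<n. cis (2 * pi * real j * (real k - real m) / real n)) = of_bool (k = m) * of_nat n"
proof (cases "k = m")
  case False
  define w where "w = cis (2 * pi * (real k - real m) / real n)"
  have "w \<noteq> 1"
  proof
    assume "w = 1"
    then have "cos (2 * pi * (real k - real m) / real n) = 1"
      by (simp add: w_def complex_eq_iff)
    \<comment> \<open>\<open>w = 1\<close> would make \<open>n\<close> divide \<open>k - m\<close>,
      impossible for distinct numbers below \<open>n\<close>.\<close>
    then obtain q :: int where "2 * pi * (real k - real m) / real n = of_int q * 2 * pi"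
      unfolding cos_one_2pi_int by blast
    then have "2 * pi * (real k - real m) = of_int q * 2 * pi * real n"
      using assms by (simp only: nonzero_divide_eq_eq of_nat_eq_0_iff)
    then have "2 * pi * of_int (int k - int m) = 2 * pi * of_int (q * int n)"
      by (simp add: mult_ac)
    then have "of_int (int k - int m) = (of_int (q * int n) :: real)"
      by (rule mult_left_cancel[THEN iffD1, rotated]) simp
    then have "int k - int m = q * int n" using of_int_eq_iff by blast
    then have "int n dvd int k - int m" by simp
    then have "int k mod int n = int m mod int n" by (simp add: mod_eq_dvd_iff)
    then show False using assms False by simp
  qed
  have "w ^ n = cis (real n * (2 * pi * (real k - real m) / real n))"
    by (simp only: w_def Complex.DeMoivre)
  also have "real n * (2 * pi * (real k - real m) / real n) = 2 * pi * of_int (int k - int m)"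
    using assms by simp
  also have "cis (2 * pi * of_int (int k - int m)) = 1"
    by (simp add: complex_eq_iff cos_int_2pin sin_int_2pin del: of_int_diff)
  finally have "(\<Sum>j<n. w ^ j) = 0"
    using geometric_sum[OF \<open>w \<noteq> 1\<close>, of n] by simp
  moreover have "w ^ j = cis (2 * pi * real j * (real k - real m) / real n)" for j
    by (simp add: w_def Complex.DeMoivre mult_ac)
  ultimately show ?thesis using False by simp
qed simp

lemma orthonormal_fourier_basis:
  assumes u: "orthonormal n u"
    and v: "\<And>k. v k = (\<Sum>j<n. (cis (2 * pi * real j * real k / real n) / of_real (sqrt (real n))) *\<^sub>C u j)"
  shows "orthonormal n v"
  unfolding orthonormal_def
proof (intro allI impI)
  fix k m assume km: "k < n" "m < n"
  have "cinner (v k) (v m) = (\<Sum>j<n. cis (2 * pi * real j * (real k - real m) / real n) / of_nat n)"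
    unfolding v cinner_orthonormal_sums[OF u]
  proof (intro sum.cong refl)
    fix j
    have "complex_of_real (sqrt (real n)) * complex_of_real (sqrt (real n)) = of_nat n"
      by (simp flip: of_real_mult)
    then show "cis (2 * pi * real j * real k / real n) / of_real (sqrt (real n))
        * cnj (cis (2 * pi * real j * real m / real n) / of_real (sqrt (real n)))
      = cis (2 * pi * real j * (real k - real m) / real n) / of_nat n"
      by (simp add: cis_cnj cis_mult right_diff_distrib diff_divide_distrib)
  qed
  also have "\<dots> = of_bool (k = m)"
    using km sum_cis_roots[OF km] by (simp flip: sum_divide_distrib)
  finally show "cinner (v k) (v m) = of_bool (k = m)" .
qed

text \<open>\<open>fejer\<close> is 1 at 0 and vanishes at the other grid points, so its translates
  act as Kronecker deltas at the nodes.\<close>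

lemma fejer_interp_grid:
  assumes l: "\<And>j. l j = 2 * pi * of_int (q j)" and "inj_on q {..<n}" "i < n" "k < n"
  shows "fejer_interp n l c (l i, l k) = c i k"
proof -
  have *: "fejer (l r - l s) = of_bool (r = s)" if "r < n" "s < n" for r s
    using fejer_grid[of "q r - q s"] assms(2) that
    by (auto simp: l right_diff_distrib dest: inj_onD)
  have "fejer_interp n l c (l i, l k)
      = (\<Sum>r<n. \<Sum>s<n. if r = i then if s = k then c i k else 0 else 0)"
    unfolding fejer_interp_def using assms(3,4) by (intro sum.cong) (auto simp: *)
  also have "\<dots> = c i k" using assms(3,4) by (simp add: sum.If_cases)
  finally show ?thesis .
qed

text \<open>A grid point that is not a node kills every translate. Applied to 0 and to the
  eigenvalues shifted by \<open>2 * pi\<close>.\<close>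

lemma fejer_interp_off_grid:
  assumes l: "\<And>j. l j = 2 * pi * of_int (q j)" and "\<And>j. j < n \<Longrightarrow> m \<noteq> q j"
  shows "fejer_interp n l c (2 * pi * of_int m, t) = 0" "fejer_interp n l c (s, 2 * pi * of_int m) = 0"
proof -
  have "fejer (2 * pi * of_int m - l j) = 0" if "j < n" for j
    using fejer_grid[of "m - q j"] assms(2)[OF that] by (simp add: l right_diff_distrib)
  then show "fejer_interp n l c (2 * pi * of_int m, t) = 0"
    "fejer_interp n l c (s, 2 * pi * of_int m) = 0"
    by (simp_all add: fejer_interp_def)
qed

text \<open>Only the first operator changes while \<open>B\<close> stays fixed; the ratio of the two
  Schatten bounds has order \<open>n powr (1 / 2 - 1 / p)\<close>.\<close>

lemma lower_bound_example:
  fixes p :: real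
  assumes "p > 0" "n \<ge> 2" "\<not> cfinite_dim (UNIV :: 'h :: complex_hilbert set)"
  obtains f :: "real \<times> real \<Rightarrow> complex" and A1 A2 B :: "'h :: complex_hilbert \<Rightarrow> 'h"
  where "smooth f" "\<And>z. norm (f z) \<le> 4"
    "distr_support (fourier_distr f) \<subseteq> {-1..1} \<times> {-1..1}"
    "finite_rank A1" "selfadjoint A1" "finite_rank A2" "selfadjoint A2"
    "finite_rank B" "selfadjoint B"
    "schatten_norm p (\<lambda>x. fun_op f A1 B x - fun_op f A2 B x) \<ge> sqrt (real n)"
    "schatten_norm p (\<lambda>x. A1 x - A2 x) \<le> real n powr (1 / p) * (2 * pi)"
proof -
  obtain u :: "nat \<Rightarrow> 'h" where u: "orthonormal n u"
    using orthonormal_exists[OF assms(3)] by blast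
  define r where "r = complex_of_real (sqrt (real n))"
  have r: "r * r = of_nat n" "r \<noteq> 0" "cnj r = r"
    using assms(2) by (auto simp: r_def simp flip: of_real_mult)
  define v where "v k = (\<Sum>j<n. (cis (2 * pi * real j * real k / real n) / r) *\<^sub>C u j)" for k
  have v: "orthonormal n v"
    using orthonormal_fourier_basis[OF u v_def[unfolded r_def]] .
  \<comment> \<open>Multiples of \<open>n\<close> give the separation \<open>2 * pi * n\<close>; the
    summand 1 avoids the node 0; and as \<open>n \<ge> 2\<close>, \<open>q i + 1\<close> is not a
    multiple of \<open>n\<close>, hence never a node.\<close>
  define q where "q j = int n * (int j + 1)" for j
  define l where "l j = 2 * pi * of_int (q j)" for j
  \<comment> \<open>The conjugate phase of \<open>cinner (v k) (u j)\<close>.\<close>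
  define c where "c j k = cis (- (2 * pi * real j * real k / real n))" for j k
  define f where "f = fejer_interp n l c"
  define A1 where "A1 = diag_op n u (\<lambda>i. complex_of_real (l i))"
  define A2 where "A2 = diag_op n u (\<lambda>i. complex_of_real (l i + 2 * pi))"
  define B where "B = diag_op n v (\<lambda>i. complex_of_real (l i))"
  have n: "n > 0" using assms(2) by simp
  have q: "inj q" using n by (auto simp: q_def inj_def)
  have q0: "0 \<noteq> q j" for j using n by (simp add: q_def)
  have q1: "q i + 1 \<noteq> q j" for i j
  proof
    assume "q i + 1 = q j"
    then have "int n * (int j - int i) = 1" by (simp add: q_def algebra_simps)
    then have "int n dvd 1" by (metis dvd_triv_left)
    then show False using assms(2) by simp
  qed
  have sep: "\<bar>l i - l j\<bar> \<ge> 2 * pi * real n" if "i \<noteq> j" for i j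
  proof -
    have "1 \<le> \<bar>real_of_int (int i - int j)\<bar>" using that by linarith
    then have "2 * pi * real n * 1 \<le> 2 * pi * real n * \<bar>real_of_int (int i - int j)\<bar>"
      by (intro mult_left_mono) auto
    also have "\<dots> = \<bar>2 * pi * real n * real_of_int (int i - int j)\<bar>"
      by (simp add: abs_mult)
    also have "2 * pi * real n * real_of_int (int i - int j) = l i - l j"
      by (simp add: l_def q_def algebra_simps)
    finally show ?thesis by simp
  qed
  have f0: "f (0, t) = 0" "f (s, 0) = 0" for s t
    using fejer_interp_off_grid[of l q n 0, OF l_def q0] by (simp_all add: f_def)
  have f1: "f (l i + 2 * pi, t) = 0" for i t
    using fejer_interp_off_grid(1)[of l q n "q i + 1", OF l_def q1]
    by (simp add: f_def l_def[of i] distrib_left)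
  have fc: "f (l i, l k) = c i k" if "i < n" "k < n" for i k
    unfolding f_def using q that by (intro fejer_interp_grid[OF l_def]) (auto intro: inj_on_subset)
  have l: "inj_on l {..<n}" "l i \<noteq> 0" for i
    using q q0[of i] by (auto simp: l_def inj_on_def inj_def)
  have "fun_op f A1 B x = cinner x (\<Sum>j<n. 1 *\<^sub>C v j) *\<^sub>C (\<Sum>i<n. (1 / r) *\<^sub>C u i)" for x
  proof -
    \<comment> \<open>The phases cancel, leaving the same coefficient \<open>1 / r\<close> for all
      \<open>i\<close> and \<open>j\<close>, so the double sum collapses to rank one.\<close>
    have vu: "c i j * cinner x (v j) * cinner (v j) (u i) = cinner x (v j) / r" if "i < n" for i j
    proof -
      have "cinner (v j) (u i) = cis (2 * pi * real i * real j / real n) / r"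
        unfolding v_def by (rule cinner_orthonormal_sum[OF u that])
      moreover have "c i j * cis (2 * pi * real i * real j / real n) = 1"
        by (simp add: c_def cis_mult)
      moreover have "c i j * cinner x (v j) * (cis (2 * pi * real i * real j / real n) / r)
          = (c i j * cis (2 * pi * real i * real j / real n)) * (cinner x (v j) / r)"
        by (simp add: mult_ac)
      ultimately show ?thesis by simp
    qed
    have "fun_op f A1 B x
        = (\<Sum>i<n. \<Sum>j<n. (f (l i, l j) * cinner x (v j) * cinner (v j) (u i)) *\<^sub>C u i)"
      unfolding A1_def B_def by (intro fun_op_diag_op u l v f0)
    also have "\<dots> = (\<Sum>i<n. \<Sum>j<n. (cinner x (v j) / r) *\<^sub>C u i)"
      by (intro sum.cong) (simp_all add: fc vu)
    also have "\<dots> = (\<Sum>i<n. ((\<Sum>j<n. cinner x (v j)) * (1 / r)) *\<^sub>C u i)"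
      by (simp add: complex_vector.scale_sum_left sum_divide_distrib)
    also have "\<dots> = cinner x (\<Sum>j<n. 1 *\<^sub>C v j) *\<^sub>C (\<Sum>i<n. (1 / r) *\<^sub>C u i)"
      by (simp only: scaleC_one cinner_sum_right complex_vector.scale_sum_right scaleC_scaleC)
    finally show ?thesis .
  qed
  moreover have "fun_op f A2 B x = 0" for x
  proof -
    \<comment> \<open>Every spectral value of \<open>A2\<close> is 0 or a shifted eigenvalue, and
      \<open>f\<close> vanishes above both.\<close>
    have "f (s, t) = 0" if "s \<in> real_spectrum A2" for s t
      using that real_spectrum_diag_op_subset[OF u, of "\<lambda>i. l i + 2 * pi"] f0 f1
      unfolding A2_def by blast
    then show ?thesis by (simp add: fun_op_def)
  qed
  ultimately have T: "(\<lambda>x. fun_op f A1 B x - fun_op f A2 B x)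
      = (\<lambda>x. cinner x (\<Sum>j<n. 1 *\<^sub>C v j) *\<^sub>C (\<Sum>i<n. (1 / r) *\<^sub>C u i))"
    by simp
  have "norm (\<Sum>j<n. 1 *\<^sub>C v j) = sqrt (real n)"
    by (rule norm_eq_sqrt_cinner) (simp add: cinner_orthonormal_sums[OF v] del: scaleC_one)
  moreover have "norm (\<Sum>i<n. (1 / r) *\<^sub>C u i) = sqrt 1"
    by (rule norm_eq_sqrt_cinner) (use r n in \<open>simp add: cinner_orthonormal_sums[OF u]\<close>)
  ultimately have lower: "sqrt (real n) \<le> schatten_norm p (\<lambda>x. fun_op f A1 B x - fun_op f A2 B x)"
    unfolding T using schatten_norm_rank_one_ge[OF assms(1), of
        "\<Sum>j<n. 1 *\<^sub>C v j" "\<Sum>i<n. (1 / r) *\<^sub>C u i"] by simp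
  \<comment> \<open>The shift by \<open>2 * pi\<close> makes the difference a multiple of one
    projection of rank at most \<open>n\<close>.\<close>
  have D: "(\<lambda>x. A1 x - A2 x) = diag_op n u (\<lambda>i. - complex_of_real (2 * pi))"
    by (simp add: A1_def A2_def diag_op_diff)
  have "onorm (diag_op n u (\<lambda>i. - complex_of_real (2 * pi))) \<le> 2 * pi"
    using norm_diag_op_const_le[OF u, of "- complex_of_real (2 * pi)"]
    by (intro onorm_bound) (simp_all add: norm_mult)
  then have upper: "schatten_norm p (\<lambda>x. A1 x - A2 x) \<le> real n powr (1 / p) * (2 * pi)"
    unfolding D by (intro schatten_norm_le[OF finite_rank_diag_op cdim_range_diag_op assms(1)])
  show ?thesis
  proof (rule that[OF _ _ _ _ _ _ _ _ _ lower upper])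
    show "norm (f z) \<le> 4" for z
      unfolding f_def by (intro norm_fejer_interp_le sep) (simp_all add: c_def)
  qed (simp_all add: f_def A1_def A2_def B_def smooth_fejer_interp distr_support_fejer_interp
      finite_rank_diag_op selfadjoint_diag_op del: of_real_add)
qed

section \<open>Comparison of growth rates in \<open>n\<close>\<close>

theorem theorem4p1:
  fixes p :: real
  assumes "p > 2"
    and "\<not> cfinite_dim (UNIV :: 'h :: complex_hilbert set)"
  shows "\<not> (\<exists>M > 0. \<forall>(f :: real \<times> real \<Rightarrow> complex) (A1 :: 'h \<Rightarrow> 'h) A2 B1 B2.
    smooth f \<and> bounded (range f) \<and>
    distr_support (fourier_distr f) \<subseteq> {-1..1} \<times> {-1..1} \<and>
    finite_rank A1 \<and> selfadjoint A1 \<and> finite_rank A2 \<and> selfadjoint A2 \<and>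
    finite_rank B1 \<and> selfadjoint B1 \<and> finite_rank B2 \<and> selfadjoint B2 \<longrightarrow>
    schatten_norm p (\<lambda>x. fun_op f A1 B1 x - fun_op f A2 B2 x)
      \<le> M * Linf_norm f *
          (schatten_norm p (\<lambda>x. A1 x - A2 x) + schatten_norm p (\<lambda>x. B1 x - B2 x)))"
    (is "\<not> (\<exists>M > 0. \<forall>f A1 A2 B1 B2. ?H f A1 A2 B1 B2 \<longrightarrow> ?T f A1 A2 B1 B2
      \<le> M * Linf_norm f * (?S A1 A2 + ?S B1 B2))")
proof
  assume "\<exists>M > 0. \<forall>f A1 A2 B1 B2. ?H f A1 A2 B1 B2 \<longrightarrow> ?T f A1 A2 B1 B2
      \<le> M * Linf_norm f * (?S A1 A2 + ?S B1 B2)"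
  then obtain M where M: "M > 0" and bound: "\<And>f A1 A2 B1 B2. ?H f A1 A2 B1 B2 \<Longrightarrow>
      ?T f A1 A2 B1 B2 \<le> M * Linf_norm f * (?S A1 A2 + ?S B1 B2)"
    by blast
  \<comment> \<open>The gap between the exponents of the lower and upper estimates, positive because
    \<open>p > 2\<close>.\<close>
  define e where "e = 1 / 2 - 1 / p"
  have p: "p > 0" "e > 0" using assms(1) by (auto simp: e_def field_simps)
  \<comment> \<open>The product of \<open>M\<close>, the bound 4 for \<open>Linf_norm f\<close> and
    the factor \<open>2 * pi\<close> from the shift of eigenvalues.\<close>
  define K where "K = 8 * pi * M"
  have le: "real n powr (e) \<le> K" if n: "n \<ge> 2" for n
  proof -
    obtain f :: "real \<times> real \<Rightarrow> complex" and A1 A2 B :: "'h :: complex_hilbert \<Rightarrow> 'h"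
      where f: "smooth f" "\<And>z. norm (f z) \<le> 4"
        "distr_support (fourier_distr f) \<subseteq> {-1..1} \<times> {-1..1}"
      and A: "finite_rank A1" "selfadjoint A1" "finite_rank A2" "selfadjoint A2"
        "finite_rank B" "selfadjoint B"
      and T: "?T f A1 A2 B B \<ge> sqrt (real n)"
      and S: "?S A1 A2 \<le> real n powr (1 / p) * (2 * pi)"
      using lower_bound_example[OF p(1) n assms(2)] by blast
    have "bounded (range f)" using f(2) by (intro boundedI[of _ 4]) blast
    then have "?H f A1 A2 B B" using f A by blast
    \<comment> \<open>With \<open>B1 = B2 = B\<close> the second Schatten norm on the right is
      0.\<close>
    from bound[OF this] have "?T f A1 A2 B B \<le> M * Linf_norm f * ?S A1 A2"
      by (simp add: schatten_norm_0[OF p(1)])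
    also have "\<dots> \<le> M * 4 * ?S A1 A2"
    proof -
      have "continuous_on UNIV f" using f(1) by (auto simp: smooth_def)
      then have "Linf_norm f \<le> 4" using f(2) by (rule Linf_norm_le)
      moreover have "?S A1 A2 \<ge> 0" by (simp add: schatten_norm_def)
      ultimately show ?thesis using M by (intro mult_right_mono mult_left_mono) auto
    qed
    also have "\<dots> \<le> M * 4 * (real n powr (1 / p) * (2 * pi))"
      using S M by (intro mult_left_mono) auto
    also have "\<dots> = K * real n powr (1 / p)" by (simp add: K_def)
    finally have "real n powr (1 / 2) \<le> K * real n powr (1 / p)"
      using T by (simp add: powr_half_sqrt)
    then have "real n powr (1 / 2) / real n powr (1 / p) \<le> K"
      using n by (simp add: pos_divide_le_eq)
    then show ?thesis by (simp only: e_def powr_diff)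
  qed
  have K: "K > 0" using M by (simp add: K_def)
  \<comment> \<open>Large enough that \<open>real n powr e \<ge> 2 * K\<close>, against the bound
    \<open>K\<close>; the 2 in the maximum ensures \<open>n \<ge> 2\<close>.\<close>
  obtain n where n: "real n > max 2 ((2 * K) powr (1 / e))"
    using reals_Archimedean2 by blast
  then have "((2 * K) powr (1 / e)) powr (e)
      \<le> real n powr (e)"
    using p by (intro powr_mono2) auto
  then have "2 * K \<le> real n powr (e)"
    using p(2) K by (simp add: powr_powr)
  then show False using le[of n] n K by simp
qed

end
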